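(* Let $G$ be a connected finite simple graph that is not a tree. The Jordan canonical forms of the matrices $B$ and $M$ associated with $G$ differ if and only if $G$ is unicyclic. Moreover, when $G$ is unicyclic, they differ only for the eigenvalue $\lambda=1$ when the cycle is odd, and only for the eigenvalues $\lambda=\pm1$ when the cycle is even. (That is, if the cycle is odd, the Jordan blocks differ for $\lambda=1$ and for no other $\lambda$; if the cycle is even, they differ for both $\lambda=1$ and $\lambda=-1$ and for no other $\lambda$.)
   Context: Let $G$ have vertex set $\{1,\dots,n\}$ and $m$ edges. A graph is unicyclic if it is connected and contains exactly one cycle; the cycle is odd (even) if its length is odd (even). Each edge $ij$ is regarded as a pair of directed edges $(i,j)$ and $(j,i)$. The non-backtracking matrix $B=B(G)$ is the $2m\times 2m$ matrix indexed by the directed edges, with $B_{(i,j),(k,l)}=1$ if $j=k$ and $i\neq l$, and $0$ otherwise. Let $A$ be the adjacency matrix and $D$ the diagonal matrix of degrees of $G$. Define $$K=K(G)=\begin{bmatrix} A & D-I_n\\ -I_n & 0\end{bmatrix},\qquad M=\begin{bmatrix} K&0&0\\0&I_{m-n}&0\\0&0&-I_{m-n}\end{bmatrix}$$ where $m\ge n$ because $G$ is connected and not a tree (if $m=n$ then $M=K$). Jordan forms are taken over $\mathbb{C}$ and up to permutation of blocks. Two matrices' Jordan forms "differ for the eigenvalue $\lambda$" if the multisets of sizes of their Jordan blocks with eigenvalue $\lambda$ are different. *)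

theory Defs
  imports
    "Graph_Theory.Graph_Theory"
    "Jordan_Normal_Form.Jordan_Normal_Form"
    "HOL-Library.Multiset"
begin

text \<open>
  A finite simple graph is a \<^locale>\<open>pair_graph\<close>: a finite, symmetric, loop-free relation
  \<^term>\<open>parcs G\<close> on \<^term>\<open>pverts G\<close>.  Thus \<^term>\<open>parcs G\<close> is exactly the set of directed
  edges, each undirected edge contributing two of them.
\<close>

definition uedges :: "'a pair_pre_digraph \<Rightarrow> 'a set set" where
  "uedges G = (\<lambda>(u, v). {u, v}) ` parcs G"

text \<open>
  A cycle of an undirected graph is a subgraph, represented here by its set of undirected edges, so
  that the choice of starting point and of orientation is immaterial.  The bound on the length
  excludes the closed walks that run back and forth along one edge, which \<^const>\<open>pre_digraph.cycle\<close>
  admits; for the same reason \<^const>\<open>tree\<close> and \<^const>\<open>forest\<close> of the library are unsuitable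
  for symmetric digraphs.  For a cycle in this sense, the length is the cardinality of the edge set.
\<close>

definition ucycles :: "'a pair_pre_digraph \<Rightarrow> 'a set set set" where
  "ucycles G = {(\<lambda>(u, v). {u, v}) ` set p | p. pre_digraph.cycle (with_proj G) p \<and> 3 \<le> length p}"

definition utree :: "'a pair_pre_digraph \<Rightarrow> bool" where
  "utree G \<longleftrightarrow> connected (with_proj G) \<and> ucycles G = {}"

definition unicyclic :: "'a pair_pre_digraph \<Rightarrow> bool" where
  "unicyclic G \<longleftrightarrow> connected (with_proj G) \<and> (\<exists>!C. C \<in> ucycles G)"

text \<open>
  The non-backtracking matrix, with rows and columns indexed by the directed edges in the order
  given by an enumeration \<open>es\<close> of \<^term>\<open>parcs G\<close>.
\<close>

definition nb_mat :: "('a \<times> 'a) list \<Rightarrow> complex mat" where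
  "nb_mat es = mat (length es) (length es) (\<lambda>(p, q).
     case (es ! p, es ! q) of ((i, j), (k, l)) \<Rightarrow> if j = k \<and> i \<noteq> l then 1 else 0)"

text \<open>
  For the following matrices the vertex set is \<open>{1..n}\<close>; since matrix indices start at \<open>0\<close>,
  index \<open>i\<close> stands for the vertex \<^term>\<open>Suc i\<close>.
\<close>

definition adjacency_mat :: "nat pair_pre_digraph \<Rightarrow> complex mat" where
  "adjacency_mat G = mat (card (pverts G)) (card (pverts G))
     (\<lambda>(i, j). if (Suc i, Suc j) \<in> parcs G then 1 else 0)"

definition deg_mat :: "nat pair_pre_digraph \<Rightarrow> complex mat" where
  "deg_mat G = mat (card (pverts G)) (card (pverts G))
     (\<lambda>(i, j). if i = j then of_nat (out_degree (with_proj G) (Suc i)) else 0)"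

definition K_mat :: "nat pair_pre_digraph \<Rightarrow> complex mat" where
  "K_mat G = (let n = card (pverts G) in
     four_block_mat (adjacency_mat G) (deg_mat G - 1\<^sub>m n) (- 1\<^sub>m n) (0\<^sub>m n n))"

text \<open>
  The subtraction on \<^typ>\<open>nat\<close> is not truncated for the graphs considered: a connected graph
  that is not a tree has at least as many edges as vertices.
\<close>

definition M_mat :: "nat pair_pre_digraph \<Rightarrow> complex mat" where
  "M_mat G = (let d = card (uedges G) - card (pverts G) in
     diag_block_mat [K_mat G, 1\<^sub>m d, - 1\<^sub>m d])"

text \<open>
  A Jordan form is given as in \<^const>\<open>jordan_nf\<close> by the list of its blocks (size, eigenvalue).
  The order of the list is arbitrary; forms are compared up to permutation as multisets.
\<close>

definition block_sizes :: "(nat \<times> complex) list \<Rightarrow> complex \<Rightarrow> nat multiset" where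
  "block_sizes bs z = image_mset fst (filter_mset (\<lambda>(k, w). w = z) (mset bs))"

end

theory Submission
  imports Defs
    "Jordan_Normal_Form.Jordan_Normal_Form_Uniqueness"
    "Jordan_Normal_Form.Jordan_Normal_Form_Existence"
begin

text \<open>
  Jordan blocks are determined by the dimensions of the kernels of \<open>(X - z)^k\<close>, so these
  dimensions are compared for \<open>X = B\<close> and \<open>X = M\<close>. Let \<open>n\<close> be the number of vertices and \<open>m\<close> the
  number of edges; \<open>M\<close> is \<open>K\<close> together with \<open>m - n\<close> blocks of size one for each of the
  eigenvalues \<open>1\<close> and \<open>-1\<close>.

  Away from \<open>z^2 = 1\<close> the matrices \<open>B\<close> and \<open>K\<close> agree. There are \<open>R\<close> and \<open>Q\<close> with \<open>B R = R K\<close>,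
  \<open>Q B = K Q\<close>, \<open>Q R = K^2 - 1\<close> and \<open>R Q = B^2 - 1\<close>. On generalised eigenspaces with \<open>z^2 \<noteq> 1\<close>
  the products are injective, hence so are \<open>R\<close> and \<open>Q\<close>, and the dimensions coincide
  (\<open>dim_gen_eigenspace_le\<close>).

  Let \<open>\<epsilon>\<close> be \<open>1\<close> or \<open>-1\<close>, and let \<open>N\<close> be the incidence matrix with \<open>n\<close> rows and \<open>m\<close> columns,
  signed for \<open>\<epsilon> = 1\<close> and unsigned for \<open>\<epsilon> = -1\<close>. The eigenspace of \<open>K\<close> for \<open>\<epsilon>\<close> is isomorphic to
  the left kernel of \<open>N\<close>, which consists of the functions with \<open>x i = \<epsilon> x j\<close> along edges. The
  eigenspace of \<open>B\<close> contains the right kernel of \<open>N\<close>, that is, the functions on arcs that change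
  by \<open>- \<epsilon>\<close> under reversal and whose outgoing sums vanish. The right kernel is larger than the
  left one by \<open>m - n\<close> dimensions, which is just what the extra blocks of \<open>M\<close> provide. If
  \<open>m \<noteq> n\<close>, or if the left kernel is zero, then \<open>B\<close> has no other eigenvectors for \<open>\<epsilon>\<close>, neither
  matrix has generalised eigenvectors of higher order, and the Jordan blocks for \<open>\<epsilon>\<close> are the
  same (\<open>dim_gen_eigenspace_no_defect\<close>). If \<open>m = n\<close> and the left kernel is nonzero, then \<open>B\<close> has
  one more eigenvector and the blocks differ (\<open>dim_eigenspace_defect\<close>). So the forms differ at
  \<open>1\<close> exactly if \<open>m = n\<close>, since constants lie in the left kernel, and at \<open>-1\<close> exactly if
  moreover the graph is bipartite.

  The same kernels describe the cycles. A cycle carries a circulation, and the support of a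
  nonzero circulation contains a cycle. The circulations have dimension \<open>m - n + 1\<close> in a
  connected graph. Hence a connected graph with a cycle has \<open>m \<ge> n\<close>, with equality exactly if
  the cycle is unique. In that case the graph is bipartite exactly if the cycle is even
  (\<open>even_cycle_iff_alternating\<close>).
\<close>

section \<open>Dimensions of kernels\<close>

text \<open>
  An injective linear map carries a basis of one kernel to an independent set of the other. If
  the dimensions agree, that set is again a basis, so the map is onto: this is how an element
  outside the image turns into a strict inequality of dimensions.
\<close>

lemma kernel_dim_le_of_injective:
  fixes A C :: "'a :: field mat" and h :: "'a vec \<Rightarrow> 'a vec"
  assumes A: "A \<in> carrier_mat nr nc" and C: "C \<in> carrier_mat nr' nc'"
    and maps: "\<And>v. v \<in> mat_kernel A \<Longrightarrow> h v \<in> mat_kernel C"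
    and add: "\<And>v w. v \<in> mat_kernel A \<Longrightarrow> w \<in> mat_kernel A \<Longrightarrow> h (v + w) = h v + h w"
    and smult: "\<And>a v. v \<in> mat_kernel A \<Longrightarrow> h (a \<cdot>\<^sub>v v) = a \<cdot>\<^sub>v h v"
    and inj: "\<And>v. v \<in> mat_kernel A \<Longrightarrow> h v = 0\<^sub>v nc' \<Longrightarrow> v = 0\<^sub>v nc"
  shows "kernel_dim A \<le> kernel_dim C \<and> (kernel_dim A = kernel_dim C \<longrightarrow> mat_kernel C \<subseteq> h ` mat_kernel A)"
proof -
  interpret KA: kernel nr nc A by unfold_locales (rule A)
  interpret KC: kernel nr' nc' C by unfold_locales (rule C)
  interpret lm: linear_map class_ring KA.VK KC.VK h
    by unfold_locales (auto simp: module_hom_def maps add smult class_ring_simps)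
  have h0: "h (0\<^sub>v nc) = 0\<^sub>v nc'" using lm.f0_is_0 by simp
  have "lm.ker = {0\<^sub>v nc}"
    unfolding lm.ker_def using inj h0 KA.Ker.module.M.zero_closed by auto
  then have injon: "inj_on h (mat_kernel A)"
    using lm.Ke0_imp_inj by simp
  obtain b where finb: "finite b" and b: "KA.basis b" using kernel_basis_exists[OF A] by auto
  have bsub: "b \<subseteq> mat_kernel A" and bli: "KA.lin_indpt b"
    using b unfolding KA.Ker.basis_def by auto
  have dimA: "KA.dim = card b" using KA.Ker.dim_basis[OF finb b] .
  obtain c where finc: "finite c" and c: "KC.basis c" using kernel_basis_exists[OF C] by auto
  have fdC: "KC.Ker.fin_dim" using c finc unfolding KC.Ker.basis_def KC.Ker.fin_dim_def by auto
  have hbsub: "h ` b \<subseteq> mat_kernel C" using bsub maps by auto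
  have hli: "KC.lin_indpt (h ` b)"
  proof (rule KC.Ker.module.finite_lin_indpt2)
    show "finite (h ` b)" using finb by simp
    show "h ` b \<subseteq> mat_kernel C" using hbsub by simp
    fix a :: "'a vec \<Rightarrow> 'a" assume z: "KC.lincomb a (h ` b) = 0\<^sub>v nc'"
    have "KC.lincomb a (h ` b) = h (KA.lincomb (a \<circ> h) b)"
      by (rule lm.lincomb_linear_image) (use injon bsub finb in auto)
    then have "h (KA.lincomb (a \<circ> h) b) = 0\<^sub>v nc'" using z by simp
    moreover have "KA.lincomb (a \<circ> h) b \<in> mat_kernel A"
      using KA.Ker.module.lincomb_closed bsub by simp
    ultimately have "KA.lincomb (a \<circ> h) b = 0\<^sub>v nc" by (intro inj)
    from KA.Ker.not_lindepD[OF bli finb subset_refl _ this]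
    have "(a \<circ> h) \<in> b \<rightarrow> {0}" by simp
    then show "\<forall>v\<in>h ` b. a v = 0" by auto
  qed
  have cardhb: "card (h ` b) = card b" by (intro card_image inj_on_subset[OF injon] bsub)
  have "card (h ` b) \<le> KC.dim" using KC.Ker.li_le_dim(2)[OF fdC _ hli] hbsub by simp
  moreover have "mat_kernel C \<subseteq> h ` mat_kernel A" if eq: "card b = KC.dim"
  proof
    fix w assume w: "w \<in> mat_kernel C"
    have "KC.basis (h ` b)"
      by (rule KC.Ker.dim_li_is_basis[OF fdC]) (use finb hbsub hli cardhb eq in auto)
    then have "w \<in> KC.span (h ` b)" using w unfolding KC.Ker.basis_def by auto
    then obtain a where w': "w = KC.lincomb a (h ` b)"
      using KC.Ker.module.finite_in_span[of "h ` b" w] finb hbsub by auto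
    also have "\<dots> = h (KA.lincomb (a \<circ> h) b)"
      by (rule lm.lincomb_linear_image) (use injon bsub finb in auto)
    finally show "w \<in> h ` mat_kernel A"
      using KA.Ker.module.lincomb_closed[of b "a \<circ> h"] bsub by simp
  qed
  ultimately show ?thesis using cardhb dimA by simp
qed

lemma kernel_dim_cong:
  assumes "mat_kernel A = mat_kernel C" "dim_col A = dim_col C"
  shows "kernel_dim A = kernel_dim C"
  using assms unfolding kernel_dim_def by simp

text \<open>
  Both kernels are visible in reduced row echelon form: with \<open>r\<close> pivots the kernel has dimension
  \<open>nc - r\<close>. A pivot column is a unit vector, so the transposed system forces exactly the first
  \<open>r\<close> coordinates to vanish, which leaves dimension \<open>nr - r\<close>.
\<close>

lemma row_echelon_kernel_index:
  fixes E :: "'a :: field mat"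
  assumes E: "E \<in> carrier_mat nr nc" and row: "row_echelon_form E"
  shows "kernel_dim E + nr = kernel_dim E\<^sup>T + nc"
proof -
  obtain f where piv: "pivot_fun E f nc" using row E unfolding row_echelon_form_def by auto
  have dE: "dim_row E = nr" "dim_col E = nc" using E by auto
  note p = pivot_funD[OF dE(1) piv]
  define S where "S = {i. i < nr \<and> f i < nc}"
  have row0: "row E i = 0\<^sub>v nc \<longleftrightarrow> i \<notin> S" if i: "i < nr" for i
  proof
    assume "row E i = 0\<^sub>v nc"
    then have "f i < nc \<Longrightarrow> E $$ (i, f i) = 0" using i dE by (metis index_row(1) index_zero_vec(1))
    then show "i \<notin> S" using p(4)[OF i] unfolding S_def by auto
  next
    assume "i \<notin> S"
    then show "row E i = 0\<^sub>v nc" using p(1,2)[OF i] i dE unfolding S_def by (intro eq_vecI) auto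
  qed
  have Sset: "{i. i < nr \<and> row E i \<noteq> 0\<^sub>v nc} = S" using row0 unfolding S_def by auto
  interpret KE: kernel nr nc E by unfold_locales (rule E)
  have kE: "kernel_dim E = nc - card S" using find_base_vectors(6)[OF row E] Sset by simp
  have finS: "finite S" unfolding S_def by auto
  have inj: "inj_on f S"
  proof (rule inj_onI)
    fix i j assume "i \<in> S" "j \<in> S" "f i = f j"
    then show "i = j" using p(4)[of i] p(5)[of j i] unfolding S_def by (metis mem_Collect_eq one_neq_zero)
  qed
  have Snc: "card S \<le> nc"
    using card_inj_on_le[OF inj, of "{..<nc}"] unfolding S_def by auto
  have Snr: "card S \<le> nr" using card_mono[of "{..<nr}" S] unfolding S_def by auto
  have ker: "y \<in> mat_kernel E\<^sup>T \<longleftrightarrow> y \<in> carrier_vec nr \<and> (\<forall>i\<in>S. y $ i = 0)" for y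
  proof (cases "y \<in> carrier_vec nr")
    case y: True
    have comp: "(E\<^sup>T *\<^sub>v y) $ j = (\<Sum>i<nr. E $$ (i,j) * y $ i)" if "j < nc" for j
      using that y dE by (auto simp: scalar_prod_def lessThan_atLeast0 intro!: sum.cong)
    have "E\<^sup>T *\<^sub>v y = 0\<^sub>v nc \<longleftrightarrow> (\<forall>i\<in>S. y $ i = 0)"
    proof
      assume z: "E\<^sup>T *\<^sub>v y = 0\<^sub>v nc"
      show "\<forall>i\<in>S. y $ i = 0"
      proof
        fix i assume i: "i \<in> S"
        then have i': "i < nr" "f i < nc" unfolding S_def by auto
        have "0 = (\<Sum>k<nr. E $$ (k, f i) * y $ k)" using comp[OF i'(2)] z i' by simp
        also have "\<dots> = (\<Sum>k<nr. if k = i then y $ i else 0)"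
          by (intro sum.cong refl) (use p(4)[OF i'(1,2)] p(5)[OF i'(1,2)] in auto)
        finally show "y $ i = 0" using i' by simp
      qed
    next
      assume z: "\<forall>i\<in>S. y $ i = 0"
      show "E\<^sup>T *\<^sub>v y = 0\<^sub>v nc"
      proof (rule eq_vecI)
        fix j assume "j < dim_vec (0\<^sub>v nc :: 'a vec)"
        then have j: "j < nc" by simp
        have "E $$ (i,j) * y $ i = 0" if i: "i < nr" for i
        proof (cases "i \<in> S")
          case False
          then have "f i = nc" using p(1)[OF i] i unfolding S_def by auto
          then show ?thesis using p(2)[OF i] j by auto
        qed (use z in auto)
        then show "(E\<^sup>T *\<^sub>v y) $ j = 0\<^sub>v nc $ j" unfolding comp[OF j] using j by (auto intro!: sum.neutral)
      qed (use dE in simp)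
    qed
    then show ?thesis using y dE by (auto simp: mat_kernel_def)
  qed (auto simp: mat_kernel_def dE)
  define r where "r = card S"
  have S_eq: "S = {..<r}"
  proof -
    have down: "i \<in> S" if "Suc i \<in> S" for i
      using p(3)[of i] p(1)[of i] that unfolding S_def by (auto simp: less_Suc_eq_le)
    have "j \<in> S" if "i \<in> S" "j \<le> i" for i j
      using that(2,1) by (induction rule: inc_induct) (auto intro: down)
    then show ?thesis unfolding r_def using finS
      by (metis card_lessThan lessThan_iff linorder_not_le nat_less_le order_refl subsetI subset_antisym
          card_subset_eq finite_lessThan psubset_card_mono less_irrefl)
  qed
  \<comment> \<open>A diagonal matrix in row echelon form with the same kernel as the transpose of \<open>E\<close>.\<close>
  define F :: "'a mat" where "F = mat nr nr (\<lambda>(i,j). if i = j \<and> i < r then 1 else 0)"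
  have Fc: "F \<in> carrier_mat nr nr" unfolding F_def by simp
  have rr: "r \<le> nr" using Snr r_def by simp
  have "pivot_fun F (\<lambda>i. if i < r then i else nr) nr"
    by (rule pivot_funI[of _ nr]) (use rr in \<open>auto simp: F_def split: if_splits\<close>)
  then have rowF: "row_echelon_form F" unfolding row_echelon_form_def using Fc by auto
  interpret KF: kernel nr nr F by unfold_locales (rule Fc)
  have "row F i = 0\<^sub>v nr \<longleftrightarrow> \<not> i < r" if "i < nr" for i
  proof
    assume "row F i = 0\<^sub>v nr"
    then have "row F i $ i = 0" using that by simp
    then show "\<not> i < r" using that by (simp add: F_def split: if_splits)
  next
    assume "\<not> i < r" then show "row F i = 0\<^sub>v nr" using that by (intro eq_vecI) (auto simp: F_def)
  qed
  then have "{i. i < nr \<and> row F i \<noteq> 0\<^sub>v nr} = {..<r}" using rr by auto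
  then have kF: "kernel_dim F = nr - r" using find_base_vectors(6)[OF rowF Fc] by simp
  have "mat_kernel E\<^sup>T = mat_kernel F"
  proof -
    have "y \<in> mat_kernel F \<longleftrightarrow> y \<in> carrier_vec nr \<and> (\<forall>i\<in>S. y $ i = 0)" for y
    proof (cases "y \<in> carrier_vec nr")
      case y: True
      have "(F *\<^sub>v y) $ i = (if i < r then y $ i else 0)" if "i < nr" for i
      proof -
        have "(F *\<^sub>v y) $ i = (\<Sum>j<nr. (if i = j \<and> i < r then 1 else 0) * y $ j)"
          using that y by (auto simp: F_def scalar_prod_def lessThan_atLeast0 intro!: sum.cong)
        also have "\<dots> = (\<Sum>j<nr. if j = i then if i < r then y $ i else 0 else 0)"
          by (intro sum.cong) auto
        finally show ?thesis using that by simp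
      qed
      then have "F *\<^sub>v y = 0\<^sub>v nr \<longleftrightarrow> (\<forall>i<nr. (if i < r then y $ i else 0) = 0)"
        using Fc by (auto simp: vec_eq_iff)
      then show ?thesis using y Fc rr unfolding S_eq by (auto simp: mat_kernel_def)
    qed (use Fc in \<open>auto simp: mat_kernel_def\<close>)
    then show ?thesis using ker by auto
  qed
  then have "kernel_dim E\<^sup>T = nr - r" using kernel_dim_cong[of "E\<^sup>T" F] kF Fc dE by simp
  then show ?thesis using kE rr Snc r_def by simp
qed

text \<open>
  Row rank equals column rank, phrased for kernels so that no rank has to be introduced. Row
  operations change neither dimension.
\<close>

lemma kernel_dim_transpose:
  fixes A :: "'a :: field mat"
  assumes A: "A \<in> carrier_mat nr nc"
  shows "kernel_dim A + nr = kernel_dim A\<^sup>T + nc"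
proof -
  define E where "E = gauss_jordan_single A"
  from gauss_jordan_single[OF A E_def[symmetric]]
  obtain P Q where EP: "E = P * A" and PQ: "P * Q = 1\<^sub>m nr" and QP: "Q * P = 1\<^sub>m nr"
    and P: "P \<in> carrier_mat nr nr" and Q: "Q \<in> carrier_mat nr nr"
    and E: "E \<in> carrier_mat nr nc" and row: "row_echelon_form E"
    by auto
  have 1: "kernel_dim E = kernel_dim A"
    using mat_kernel_mult_eq[OF A P Q QP] EP by (intro kernel_dim_cong) auto
  have ET: "E\<^sup>T = A\<^sup>T * P\<^sup>T" unfolding EP by (rule transpose_mult[OF P A])
  have "P\<^sup>T * Q\<^sup>T = 1\<^sub>m nr" using QP transpose_mult[OF Q P] by (metis transpose_one)
  then have "kernel.dim nr (A\<^sup>T * P\<^sup>T) = kernel.dim nr A\<^sup>T"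
    by (intro mat_kernel_dim_mult_eq_right[of _ nc nr _ "Q\<^sup>T"]) (use A P Q in auto)
  then have 2: "kernel_dim E\<^sup>T = kernel_dim A\<^sup>T"
    unfolding kernel_dim_def ET using A P by simp
  show ?thesis using row_echelon_kernel_index[OF E row] 1 2 by simp
qed

section \<open>Jordan blocks and generalised eigenspaces\<close>

lemma dim_gen_eigenspace_block_sizes:
  assumes "jordan_nf A bs"
  shows "dim_gen_eigenspace A z k = (\<Sum>s\<in>#block_sizes bs z. min k s)"
proof -
  have "mset (map fst [(n, e)\<leftarrow>bs . e = z]) = block_sizes bs z"
    unfolding block_sizes_def by (simp flip: mset_filter mset_map add: case_prod_beta')
  moreover have "(\<Sum>s\<leftarrow>map fst [(n, e)\<leftarrow>bs . e = z]. min k s)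
      = (\<Sum>s\<in>#mset (map fst [(n, e)\<leftarrow>bs . e = z]). min k s)"
    by (simp only: mset_map[symmetric] sum_mset_sum_list)
  ultimately show ?thesis unfolding dim_gen_eigenspace[OF assms] by simp
qed

text \<open>
  The generalised eigenspaces determine the Jordan blocks: the number of blocks of size \<open>k\<close> is a
  second difference of their dimensions. Size \<open>0\<close> is excluded by the definition of a Jordan
  form.
\<close>

lemma block_sizes_eq_iff:
  assumes A: "jordan_nf A bs" and C: "jordan_nf C cs"
  shows "block_sizes bs z = block_sizes cs z \<longleftrightarrow> (\<forall>k. dim_gen_eigenspace A z k = dim_gen_eigenspace C z k)"
proof
  assume "block_sizes bs z = block_sizes cs z"
  then show "\<forall>k. dim_gen_eigenspace A z k = dim_gen_eigenspace C z k"
    using dim_gen_eigenspace_block_sizes A C by metis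
next
  assume dim: "\<forall>k. dim_gen_eigenspace A z k = dim_gen_eigenspace C z k"
  have count: "count (block_sizes ds z) k = length (filter ((=) (k, z)) ds)" for ds :: "(nat \<times> complex) list" and k
    unfolding block_sizes_def by (induction ds) auto
  have "count (block_sizes bs z) k = count (block_sizes cs z) k" for k
  proof (cases "k = 0")
    case True
    have "length (filter ((=) (0, z)) ds) = 0" if "jordan_nf D ds" for D ds
      using that unfolding jordan_nf_def by (force simp: filter_empty_conv)
    then show ?thesis unfolding count True using A C by metis
  next
    case False
    then show ?thesis unfolding count
      using compute_nr_of_jordan_blocks[OF A False, of z] compute_nr_of_jordan_blocks[OF C False, of z] dim
      by (simp add: compute_nr_of_jordan_blocks_def)
  qed
  then show "block_sizes bs z = block_sizes cs z" by (rule multiset_eqI)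
qed

lemma mset_eq_iff_block_sizes_eq:
  "mset bs = mset cs \<longleftrightarrow> (\<forall>z. block_sizes bs z = block_sizes cs z)"
proof
  assume eq: "\<forall>z. block_sizes bs z = block_sizes cs z"
  have count: "count (block_sizes ds z) k = count (mset ds) (k, z)" for ds z k
    unfolding block_sizes_def by (induction ds) auto
  show "mset bs = mset cs"
  proof (rule multiset_eqI)
    fix x :: "nat \<times> complex"
    show "count (mset bs) x = count (mset cs) x"
      using count[of bs "snd x" "fst x"] count[of cs "snd x" "fst x"] eq by simp
  qed
qed (simp add: block_sizes_def)

lemma smult_mat_mult_vec:
  fixes A :: "'a :: comm_semiring_0 mat"
  assumes "A \<in> carrier_mat nr nc" "v \<in> carrier_vec nc"
  shows "(a \<cdot>\<^sub>m A) *\<^sub>v v = a \<cdot>\<^sub>v (A *\<^sub>v v)"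
  using assms by (intro eq_vecI) (auto simp: scalar_prod_def sum_distrib_left ac_simps)

text \<open>
  The hypothesis says that the kernel of \<open>X\<close> meets its range trivially, so the increasing chain
  of kernels of powers is stationary from the first power on.
\<close>

lemma mat_kernel_pow:
  fixes X :: "'a :: field mat"
  assumes X: "X \<in> carrier_mat n n"
    and sq: "\<And>v. v \<in> carrier_vec n \<Longrightarrow> X *\<^sub>v (X *\<^sub>v v) = 0\<^sub>v n \<Longrightarrow> X *\<^sub>v v = 0\<^sub>v n"
  shows "mat_kernel (X ^\<^sub>m Suc k) = mat_kernel X"
proof (induction k)
  case 0
  then show ?case using X by simp
next
  case (Suc k)
  have Xk: "X ^\<^sub>m j \<in> carrier_mat n n" for j by (rule pow_carrier_mat[OF X])
  have step: "v \<in> mat_kernel (X ^\<^sub>m Suc (Suc k)) \<longleftrightarrow> v \<in> carrier_vec n \<and> X *\<^sub>v v \<in> mat_kernel (X ^\<^sub>m Suc k)" for v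
  proof (cases "v \<in> carrier_vec n")
    case True
    then show ?thesis
      using assoc_mult_mat_vec[OF Xk[of "Suc k"] X True] X
      by (simp add: mat_kernel[OF Xk[of "Suc (Suc k)"]] mat_kernel[OF Xk[of "Suc k"]] del: pow_mat.simps)
        (simp add: pow_mat.simps(2)[of X "Suc k"] del: pow_mat.simps)
  qed (simp add: mat_kernel[OF Xk] del: pow_mat.simps)
  show ?case unfolding set_eq_iff step Suc.IH mat_kernel[OF X] using X sq by auto
qed

section \<open>Matrices as operators on functions\<close>

text \<open>
  Vectors whose coordinates are indexed by the entries of a list are handled as functions on
  these entries; \<open>fun_on\<close> is the inverse translation for distinct entries, extended by \<open>0\<close>. The
  sum in its definition avoids a choice of the index and makes it visibly linear.
\<close>

definition vec_on :: "'b list \<Rightarrow> ('b \<Rightarrow> 'a) \<Rightarrow> 'a vec" where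
  "vec_on ys f = vec (length ys) (\<lambda>i. f (ys ! i))"

definition fun_on :: "'b list \<Rightarrow> 'a :: field vec \<Rightarrow> 'b \<Rightarrow> 'a" where
  "fun_on ys v y = (\<Sum>i<length ys. if ys ! i = y then v $ i else 0)"

lemma vec_on_carrier [simp]: "vec_on ys f \<in> carrier_vec (length ys)"
  by (simp add: vec_on_def)

lemma vec_on_fun_on:
  assumes "distinct ys" "v \<in> carrier_vec (length ys)"
  shows "vec_on ys (fun_on ys v) = v"
proof (rule eq_vecI)
  fix i assume "i < dim_vec v"
  then have i: "i < length ys" using assms by simp
  have "fun_on ys v (ys ! i) = (\<Sum>j<length ys. if j = i then v $ i else 0)"
    unfolding fun_on_def by (intro sum.cong refl) (use assms i nth_eq_iff_index_eq in fastforce)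
  then show "vec_on ys (fun_on ys v) $ i = v $ i" using i by (simp add: vec_on_def)
qed (use assms in \<open>simp add: vec_on_def\<close>)

lemma vec_on_eq_iff: "vec_on ys f = vec_on ys g \<longleftrightarrow> (\<forall>y\<in>set ys. f y = g y)"
  by (auto simp: vec_on_def vec_eq_iff all_set_conv_all_nth)

lemma vec_on_eq_0_iff: "vec_on ys f = 0\<^sub>v (length ys) \<longleftrightarrow> (\<forall>y\<in>set ys. f y = 0)"
  by (auto simp: vec_on_def vec_eq_iff all_set_conv_all_nth)

lemma vec_on_add: "vec_on ys (\<lambda>y. f y + g y) = vec_on ys f + vec_on ys g"
  by (auto simp: vec_on_def)

lemma vec_on_smult: "vec_on ys (\<lambda>y. a * f y) = a \<cdot>\<^sub>v vec_on ys f"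
  by (auto simp: vec_on_def)

lemma fun_on_add:
  assumes "v \<in> carrier_vec (length ys)" "w \<in> carrier_vec (length ys)"
  shows "fun_on ys (v + w) = (\<lambda>y. fun_on ys v y + fun_on ys w y)"
  unfolding fun_on_def fun_eq_iff sum.distrib[symmetric]
  by (intro allI sum.cong refl) (use assms in auto)

lemma fun_on_smult:
  assumes "v \<in> carrier_vec (length ys)"
  shows "fun_on ys (a \<cdot>\<^sub>v v) = (\<lambda>y. a * fun_on ys v y)"
  unfolding fun_on_def fun_eq_iff sum_distrib_left
  by (intro allI sum.cong refl) (use assms in auto)

text \<open>
  Operators on functions replace matrices wherever sums over neighbourhoods have to be
  manipulated. The matrix is determined by the operator when the column index list has distinct
  entries.
\<close>

definition acts_as :: "'c list \<Rightarrow> 'b list \<Rightarrow> 'a :: field mat \<Rightarrow> (('b \<Rightarrow> 'a) \<Rightarrow> 'c \<Rightarrow> 'a) \<Rightarrow> bool" where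
  "acts_as xs ys M \<Phi> \<longleftrightarrow> M \<in> carrier_mat (length xs) (length ys) \<and>
     (\<forall>f. M *\<^sub>v vec_on ys f = vec_on xs (\<Phi> f))"

lemma acts_as_carrier: "acts_as xs ys M \<Phi> \<Longrightarrow> M \<in> carrier_mat (length xs) (length ys)"
  by (simp add: acts_as_def)

lemma acts_as_mat:
  assumes "distinct ys"
    and "\<And>f x. x \<in> set xs \<Longrightarrow> \<Phi> f x = (\<Sum>y\<in>set ys. F x y * f y)"
  shows "acts_as xs ys (mat (length xs) (length ys) (\<lambda>(i, j). F (xs ! i) (ys ! j))) \<Phi>"
proof -
  have "(mat (length xs) (length ys) (\<lambda>(i, j). F (xs ! i) (ys ! j)) *\<^sub>v vec_on ys f) $ i = \<Phi> f (xs ! i)"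
    if i: "i < length xs" for f i
  proof -
    have "(\<Sum>y\<in>set ys. F (xs ! i) y * f y) = (\<Sum>j<length ys. F (xs ! i) (ys ! j) * f (ys ! j))"
      by (rule sum.reindex_bij_betw[OF bij_betw_nth, symmetric]) (use assms(1) in auto)
    then show ?thesis using i assms(2)[of "xs ! i" f]
      by (auto simp: vec_on_def scalar_prod_def lessThan_atLeast0 intro!: sum.cong)
  qed
  then show ?thesis by (auto simp: acts_as_def vec_on_def intro!: eq_vecI)
qed

lemma acts_as_mult:
  assumes "acts_as xs ys M \<Phi>" "acts_as ys zs N \<Psi>"
  shows "acts_as xs zs (M * N) (\<lambda>f. \<Phi> (\<Psi> f))"
proof -
  have M: "M \<in> carrier_mat (length xs) (length ys)" and N: "N \<in> carrier_mat (length ys) (length zs)"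
    using assms by (simp_all add: acts_as_def)
  then show ?thesis using assms by (simp add: acts_as_def assoc_mult_mat_vec[OF M N vec_on_carrier])
qed

lemma acts_as_add_smult:
  assumes "acts_as xs ys M \<Phi>" "acts_as xs ys N \<Psi>"
  shows "acts_as xs ys (M + a \<cdot>\<^sub>m N) (\<lambda>f x. \<Phi> f x + a * \<Psi> f x)"
proof -
  have M: "M \<in> carrier_mat (length xs) (length ys)" and N: "N \<in> carrier_mat (length xs) (length ys)"
    using assms by (simp_all add: acts_as_def)
  have "(M + a \<cdot>\<^sub>m N) *\<^sub>v vec_on ys f = M *\<^sub>v vec_on ys f + a \<cdot>\<^sub>v (N *\<^sub>v vec_on ys f)" for f
    using add_mult_distrib_mat_vec[OF M smult_carrier_mat[OF N] vec_on_carrier]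
      smult_mat_mult_vec[OF N vec_on_carrier] by metis
  then show ?thesis using assms M N by (simp add: acts_as_def vec_on_add vec_on_smult)
qed

lemma acts_as_one: "acts_as xs xs (1\<^sub>m (length xs)) (\<lambda>f. f)"
  by (auto simp: acts_as_def)

lemma acts_as_char_matrix:
  assumes "acts_as xs xs M \<Phi>"
  shows "acts_as xs xs (char_matrix M z) (\<lambda>f x. \<Phi> f x - z * f x)"
proof -
  have "dim_row M = length xs" using assms by (auto simp: acts_as_def)
  then show ?thesis unfolding char_matrix_def
    using acts_as_add_smult[OF assms acts_as_one, of "- z"] by simp
qed

lemma acts_as_unique:
  assumes ys: "distinct ys" and M: "acts_as xs ys M \<Phi>" and N: "acts_as xs ys N \<Psi>"
    and eq: "\<And>f x. x \<in> set xs \<Longrightarrow> \<Phi> f x = \<Psi> f x"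
  shows "M = N"
proof (rule eq_matI)
  fix i j assume ij: "i < dim_row N" "j < dim_col N"
  have d: "M \<in> carrier_mat (length xs) (length ys)" "N \<in> carrier_mat (length xs) (length ys)"
    using M N by (auto simp: acts_as_def)
  have "M *\<^sub>v v = N *\<^sub>v v" if "v \<in> carrier_vec (length ys)" for v
  proof -
    have "M *\<^sub>v vec_on ys (fun_on ys v) = N *\<^sub>v vec_on ys (fun_on ys v)"
      using M N eq by (simp add: acts_as_def vec_on_eq_iff)
    then show ?thesis using vec_on_fun_on[OF ys that] by simp
  qed
  then have "(M *\<^sub>v unit_vec (length ys) j) $ i = (N *\<^sub>v unit_vec (length ys) j) $ i" by simp
  then show "M $$ (i,j) = N $$ (i,j)" using d ij by (simp add: scalar_prod_right_unit)
qed (use M N in \<open>auto simp: acts_as_def\<close>)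

lemma kernel_dim_mono:
  fixes \<Phi> :: "('b \<Rightarrow> 'a :: field) \<Rightarrow> 'c \<Rightarrow> 'a" and \<Phi>' :: "('b' \<Rightarrow> 'a) \<Rightarrow> 'c' \<Rightarrow> 'a"
  assumes dist: "distinct ys" "distinct ys'"
    and A: "acts_as xs ys A \<Phi>" and C: "acts_as xs' ys' C \<Phi>'"
    and add: "\<And>f g. \<Psi> (\<lambda>y. f y + g y) = (\<lambda>y. \<Psi> f y + \<Psi> g y)"
    and smult: "\<And>a f. \<Psi> (\<lambda>y. a * f y) = (\<lambda>y. a * \<Psi> f y)"
    and maps: "\<And>f. \<forall>x\<in>set xs. \<Phi> f x = 0 \<Longrightarrow> \<forall>x\<in>set xs'. \<Phi>' (\<Psi> f) x = 0"
    and inj: "\<And>f. \<forall>x\<in>set xs. \<Phi> f x = 0 \<Longrightarrow> \<forall>y\<in>set ys'. \<Psi> f y = 0 \<Longrightarrow> \<forall>y\<in>set ys. f y = 0"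
  shows "kernel_dim A \<le> kernel_dim C"
    and "kernel_dim A = kernel_dim C \<Longrightarrow> \<forall>x\<in>set xs'. \<Phi>' g x = 0 \<Longrightarrow>
      \<exists>f. (\<forall>x\<in>set xs. \<Phi> f x = 0) \<and> (\<forall>y\<in>set ys'. g y = \<Psi> f y)"
proof -
  define h where "h v = vec_on ys' (\<Psi> (fun_on ys v))" for v
  have cA: "A \<in> carrier_mat (length xs) (length ys)" and cC: "C \<in> carrier_mat (length xs') (length ys')"
    using A C by (auto simp: acts_as_def)
  have kC: "vec_on ys' f \<in> mat_kernel C \<longleftrightarrow> (\<forall>x\<in>set xs'. \<Phi>' f x = 0)" for f
    using C by (auto simp: mat_kernel[OF cC] acts_as_def vec_on_eq_0_iff)
  have kA: "v \<in> mat_kernel A \<longleftrightarrow> v \<in> carrier_vec (length ys) \<and> (\<forall>x\<in>set xs. \<Phi> (fun_on ys v) x = 0)" for v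
  proof (cases "v \<in> carrier_vec (length ys)")
    case True
    have "A *\<^sub>v v = vec_on xs (\<Phi> (fun_on ys v))"
      using A vec_on_fun_on[OF dist(1) True] by (metis acts_as_def)
    then show ?thesis using True by (simp add: mat_kernel[OF cA] vec_on_eq_0_iff)
  qed (simp add: mat_kernel[OF cA])
  have main: "kernel_dim A \<le> kernel_dim C \<and>
      (kernel_dim A = kernel_dim C \<longrightarrow> mat_kernel C \<subseteq> h ` mat_kernel A)"
  proof (rule kernel_dim_le_of_injective[OF cA cC])
    fix v assume v: "v \<in> mat_kernel A"
    then show "h v \<in> mat_kernel C" unfolding h_def kC using maps kA by blast
    show "h (a \<cdot>\<^sub>v v) = a \<cdot>\<^sub>v h v" for a
      using v kA by (simp add: h_def fun_on_smult smult vec_on_smult)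
    show "h (v + w) = h v + h w" if "w \<in> mat_kernel A" for w
      using v that kA by (simp add: h_def fun_on_add add vec_on_add)
    assume "h v = 0\<^sub>v (length ys')"
    then have "\<forall>y\<in>set ys. fun_on ys v y = 0"
      unfolding h_def vec_on_eq_0_iff using inj v kA by blast
    then have "vec_on ys (fun_on ys v) = 0\<^sub>v (length ys)" by (simp add: vec_on_eq_0_iff)
    then show "v = 0\<^sub>v (length ys)" using v kA vec_on_fun_on[OF dist(1)] by metis
  qed
  then show "kernel_dim A \<le> kernel_dim C" ..
  assume eq: "kernel_dim A = kernel_dim C" and g: "\<forall>x\<in>set xs'. \<Phi>' g x = 0"
  then obtain v where v: "v \<in> mat_kernel A" "vec_on ys' g = h v" using main kC[of g] by auto
  then show "\<exists>f. (\<forall>x\<in>set xs. \<Phi> f x = 0) \<and> (\<forall>y\<in>set ys'. g y = \<Psi> f y)"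
    unfolding h_def vec_on_eq_iff using kA by blast
qed

section \<open>Intertwined matrices\<close>

lemma char_matrix_pow_intertwine:
  assumes B: "B \<in> carrier_mat b b" and K: "K \<in> carrier_mat k k" and R: "R \<in> carrier_mat b k"
    and BR: "B * R = R * K"
  shows "char_matrix B z ^\<^sub>m j * R = R * char_matrix K z ^\<^sub>m j"
proof (induction j)
  case 0
  have "dim_row (char_matrix B z) = b" "dim_row (char_matrix K z) = k"
    using B K by (simp_all add: char_matrix_def)
  then show ?case using R by simp
next
  case (Suc j)
  have cB: "char_matrix B z \<in> carrier_mat b b" "char_matrix B z ^\<^sub>m j \<in> carrier_mat b b"
    and cK: "char_matrix K z \<in> carrier_mat k k" "char_matrix K z ^\<^sub>m j \<in> carrier_mat k k"
    using B K by auto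
  have 1: "char_matrix B z * R = R * char_matrix K z"
  proof -
    have "char_matrix B z * R = B * R + ((- z) \<cdot>\<^sub>m 1\<^sub>m b) * R"
      unfolding char_matrix_def using B R by (subst add_mult_distrib_mat[of B b b]) auto
    also have "((- z) \<cdot>\<^sub>m 1\<^sub>m b) * R = (- z) \<cdot>\<^sub>m R"
      using mult_smult_assoc_mat[of "1\<^sub>m b" b b R k] R by simp
    also have "(- z) \<cdot>\<^sub>m R = R * ((- z) \<cdot>\<^sub>m 1\<^sub>m k)"
      using mult_smult_distrib[OF R, of "1\<^sub>m k" k] R by simp
    also have "B * R + \<dots> = R * char_matrix K z"
      unfolding char_matrix_def BR using K R by (subst mult_add_distrib_mat[of R b k]) auto
    finally show ?thesis .
  qed
  have "char_matrix B z ^\<^sub>m Suc j * R = char_matrix B z ^\<^sub>m j * (char_matrix B z * R)"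
    using assoc_mult_mat[OF cB(2,1) R] by simp
  also have "\<dots> = char_matrix B z ^\<^sub>m j * R * char_matrix K z"
    unfolding 1 using assoc_mult_mat[OF cB(2) R cK(1)] by simp
  also have "\<dots> = R * char_matrix K z ^\<^sub>m Suc j"
    unfolding Suc using assoc_mult_mat[OF R cK(2,1)] by simp
  finally show ?case .
qed

text \<open>
  The polynomials \<open>(t - z)^j\<close> and \<open>t^2 - 1\<close> are coprime when \<open>z^2 \<noteq> 1\<close>.
\<close>

lemma gen_eigenvector_not_fixed_by_square:
  fixes K :: "'a :: field mat"
  assumes K: "K \<in> carrier_mat k k" and z: "z * z \<noteq> 1"
    and v: "v \<in> mat_kernel (char_matrix K z ^\<^sub>m j)" and KK: "K *\<^sub>v (K *\<^sub>v v) = v"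
  shows "v = 0\<^sub>v k"
  using v KK
proof (induction j arbitrary: v)
  case 0
  then show ?case using K mat_kernelD[of "1\<^sub>m k" k k v] by (simp add: char_matrix_def)
next
  case (Suc j)
  let ?X = "char_matrix K z"
  have X: "?X \<in> carrier_mat k k" "?X ^\<^sub>m j \<in> carrier_mat k k" "?X ^\<^sub>m Suc j \<in> carrier_mat k k"
    using K by (auto simp del: pow_mat.simps)
  have v: "v \<in> carrier_vec k" using mat_kernelD[OF X(3) Suc.prems(1)] by auto
  have Xv: "?X *\<^sub>v w = K *\<^sub>v w - z \<cdot>\<^sub>v w" if "w \<in> carrier_vec k" for w
    using K that unfolding char_matrix_def
    by (simp add: add_mult_distrib_mat_vec[of _ k k] smult_mat_mult_vec[of _ k k], intro eq_vecI) auto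
  have "?X *\<^sub>v v \<in> mat_kernel (?X ^\<^sub>m j)"
    using mat_kernelD[OF X(3) Suc.prems(1)] X v assoc_mult_mat_vec[OF X(2,1) v]
    by (intro mat_kernelI[OF X(2)]) auto
  moreover have "K *\<^sub>v (K *\<^sub>v (?X *\<^sub>v v)) = ?X *\<^sub>v v"
    unfolding Xv[OF v] using K v Suc.prems(2)
    by (simp add: mult_minus_distrib_mat_vec[of _ k k] mult_mat_vec[of _ k k])
  ultimately have "?X *\<^sub>v v = 0\<^sub>v k" by (rule Suc.IH)
  then have Kv: "K *\<^sub>v v = z \<cdot>\<^sub>v v"
    using Xv[OF v] K v by (auto simp: vec_eq_iff)
  then have "v = z \<cdot>\<^sub>v (z \<cdot>\<^sub>v v)" using Suc.prems(2) K v by (simp add: mult_mat_vec)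
  then have "v $ i = z * z * v $ i" if "i < k" for i
    using that v by (metis carrier_vecD index_smult_vec(1) index_smult_vec(2) mult.assoc)
  then have "v $ i = 0" if "i < k" for i
    using that z by (metis mult_cancel_right1)
  then show ?case using v by (intro eq_vecI) auto
qed

text \<open>
  The intertwiner \<open>R\<close> maps generalised eigenspaces of \<open>K\<close> to those of \<open>B\<close>. It is injective on
  them because already \<open>Q R = K^2 - 1\<close> is injective there when \<open>z^2 \<noteq> 1\<close>. Used in both
  directions, with the roles of \<open>B\<close> and \<open>K\<close> exchanged, this gives equality.
\<close>

lemma dim_gen_eigenspace_le:
  fixes B K :: "'a :: field mat"
  assumes B: "B \<in> carrier_mat b b" and K: "K \<in> carrier_mat k k"
    and R: "R \<in> carrier_mat b k" and Q: "Q \<in> carrier_mat k b"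
    and BR: "B * R = R * K" and QR: "Q * R = K * K - 1\<^sub>m k" and z: "z * z \<noteq> 1"
  shows "dim_gen_eigenspace K z j \<le> dim_gen_eigenspace B z j"
proof -
  let ?X = "char_matrix K z ^\<^sub>m j" and ?Y = "char_matrix B z ^\<^sub>m j"
  have X: "?X \<in> carrier_mat k k" and Y: "?Y \<in> carrier_mat b b" using B K by auto
  note comm = char_matrix_pow_intertwine[OF B K R BR, of z j]
  have "kernel_dim ?X \<le> kernel_dim ?Y \<and>
      (kernel_dim ?X = kernel_dim ?Y \<longrightarrow> mat_kernel ?Y \<subseteq> (*\<^sub>v) R ` mat_kernel ?X)"
  proof (rule kernel_dim_le_of_injective[OF X Y])
    fix v assume v: "v \<in> mat_kernel ?X"
    then have vc: "v \<in> carrier_vec k" and v0: "?X *\<^sub>v v = 0\<^sub>v k" using mat_kernelD[OF X] by auto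
    have "?Y *\<^sub>v (R *\<^sub>v v) = R *\<^sub>v (?X *\<^sub>v v)"
      by (simp only: assoc_mult_mat_vec[OF Y R vc, symmetric] assoc_mult_mat_vec[OF R X vc, symmetric] comm)
    also have "\<dots> = 0\<^sub>v b" unfolding v0 using R by (intro eq_vecI) auto
    finally show "R *\<^sub>v v \<in> mat_kernel ?Y" by (rule mat_kernelI[OF Y mult_mat_vec_carrier[OF R vc]])
    show "R *\<^sub>v (v + w) = R *\<^sub>v v + R *\<^sub>v w" if "w \<in> mat_kernel ?X" for w
      using mat_kernelD(1)[OF X that] by (rule mult_add_distrib_mat_vec[OF R vc])
    show "R *\<^sub>v (a \<cdot>\<^sub>v v) = a \<cdot>\<^sub>v (R *\<^sub>v v)" for a using mult_mat_vec[OF R vc] .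
    assume Rv: "R *\<^sub>v v = 0\<^sub>v b"
    have "0\<^sub>v k = Q *\<^sub>v (R *\<^sub>v v)" unfolding Rv using Q by (intro eq_vecI) auto
    also have "\<dots> = (Q * R) *\<^sub>v v" by (rule assoc_mult_mat_vec[OF Q R vc, symmetric])
    also have "\<dots> = K *\<^sub>v (K *\<^sub>v v) - v"
    proof -
      have "(K * K - 1\<^sub>m k) *\<^sub>v v = (K * K) *\<^sub>v v - 1\<^sub>m k *\<^sub>v v"
        by (rule minus_mult_distrib_mat_vec[OF mult_carrier_mat[OF K K] one_carrier_mat vc])
      then show ?thesis unfolding QR assoc_mult_mat_vec[OF K K vc] one_mult_mat_vec[OF vc] .
    qed
    finally have diff0: "0\<^sub>v k = K *\<^sub>v (K *\<^sub>v v) - v" .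
    have "K *\<^sub>v (K *\<^sub>v v) = v"
    proof (rule eq_vecI)
      fix i assume i: "i < dim_vec v"
      then have "(K *\<^sub>v (K *\<^sub>v v) - v) $ i = 0" using vc by (simp flip: diff0)
      then show "(K *\<^sub>v (K *\<^sub>v v)) $ i = v $ i" by (simp only: index_minus_vec(1)[OF i]) simp
    qed (use K vc in simp)
    then show "v = 0\<^sub>v k" by (rule gen_eigenvector_not_fixed_by_square[OF K z v])
  qed
  then show ?thesis unfolding dim_gen_eigenspace_def ..
qed

section \<open>Solvability of linear systems\<close>

text \<open>
  If the system had no solution, appending \<open>w\<close> as a further column would not enlarge the kernel.
  The orthogonality condition says that this column does not shrink the kernel of the transpose
  either. Then the comparison of a kernel with that of the transpose for the two matrices would
  count one column too many.
\<close>

lemma fredholm_solvable: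
  fixes F :: "'c \<Rightarrow> 'b \<Rightarrow> 'a :: field"
  assumes dist: "distinct xs" "distinct ys"
    and orth: "\<And>h. \<forall>y\<in>set ys. (\<Sum>x\<in>set xs. F x y * h x) = 0 \<Longrightarrow> (\<Sum>x\<in>set xs. w x * h x) = 0"
  shows "\<exists>g. \<forall>x\<in>set xs. (\<Sum>y\<in>set ys. F x y * g y) = w x"
proof (rule ccontr)
  assume unsolvable: "\<not> ?thesis"
  \<comment> \<open>The index \<open>None\<close> stands for the appended column \<open>w\<close>.\<close>
  define zs where "zs = None # map Some ys"
  define F' where "F' x z = (case z of None \<Rightarrow> w x | Some y \<Rightarrow> F x y)" for x z
  define A where "A = mat (length xs) (length ys) (\<lambda>(i, j). F (xs ! i) (ys ! j))"
  define A' where "A' = mat (length xs) (length zs) (\<lambda>(i, j). F' (xs ! i) (zs ! j))"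
  have dz: "distinct zs" using dist by (simp add: zs_def distinct_map)
  have AT: "A\<^sup>T = mat (length ys) (length xs) (\<lambda>(i, j). F (xs ! j) (ys ! i))"
    and AT': "A'\<^sup>T = mat (length zs) (length xs) (\<lambda>(i, j). F' (xs ! j) (zs ! i))"
    by (auto simp: A_def A'_def)
  have sumz: "(\<Sum>z\<in>set zs. F' x z * f z) = w x * f None + (\<Sum>y\<in>set ys. F x y * f (Some y))" for x f
    unfolding zs_def F'_def by (simp add: sum.reindex)
  have aA: "acts_as xs ys A (\<lambda>f x. \<Sum>y\<in>set ys. F x y * f y)"
    unfolding A_def by (rule acts_as_mat) (use dist in auto)
  have aA': "acts_as xs zs A' (\<lambda>f x. w x * f None + (\<Sum>y\<in>set ys. F x y * f (Some y)))"
    unfolding A'_def by (rule acts_as_mat) (use dz sumz in auto)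
  have aT: "acts_as ys xs A\<^sup>T (\<lambda>h y. \<Sum>x\<in>set xs. F x y * h x)"
    unfolding AT by (rule acts_as_mat[where F = "\<lambda>y x. F x y"]) (use dist in auto)
  have aT': "acts_as zs xs A'\<^sup>T (\<lambda>h z. \<Sum>x\<in>set xs. F' x z * h x)"
    unfolding AT' by (rule acts_as_mat[where F = "\<lambda>z x. F' x z"]) (use dist in auto)
  have "kernel_dim A\<^sup>T \<le> kernel_dim A'\<^sup>T"
  proof (rule kernel_dim_mono(1)[OF dist(1) dist(1) aT aT', of "\<lambda>f. f"])
    fix h assume "\<forall>y\<in>set ys. (\<Sum>x\<in>set xs. F x y * h x) = 0"
    with orth[of h] show "\<forall>z\<in>set zs. (\<Sum>x\<in>set xs. F' x z * h x) = 0"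
      by (simp add: zs_def F'_def)
  qed simp_all
  moreover have "kernel_dim A' \<le> kernel_dim A"
  proof (rule kernel_dim_mono(1)[OF dz dist(2) aA' aA, of "\<lambda>f y. f (Some y)"])
    fix f assume f: "\<forall>x\<in>set xs. w x * f None + (\<Sum>y\<in>set ys. F x y * f (Some y)) = 0"
    have f0: "f None = 0"
    proof (rule ccontr)
      assume nz: "f None \<noteq> 0"
      have "(\<Sum>y\<in>set ys. F x y * (- f (Some y) / f None)) = w x" if "x \<in> set xs" for x
      proof -
        have "(\<Sum>y\<in>set ys. F x y * (- f (Some y) / f None)) = - (\<Sum>y\<in>set ys. F x y * f (Some y)) / f None"
          unfolding sum_divide_distrib sum_negf[symmetric] by (intro sum.cong refl) simp
        also have "- (\<Sum>y\<in>set ys. F x y * f (Some y)) = w x * f None"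
          using f that by (simp add: eq_neg_iff_add_eq_0[symmetric])
        also have "w x * f None / f None = w x" using nz by simp
        finally show ?thesis .
      qed
      then have "\<forall>x\<in>set xs. (\<Sum>y\<in>set ys. F x y * (- f (Some y) / f None)) = w x" by (rule ballI)
      then have "\<exists>g. \<forall>x\<in>set xs. (\<Sum>y\<in>set ys. F x y * g y) = w x"
        by (rule exI[of _ "\<lambda>y. - f (Some y) / f None"])
      with unsolvable show False by (rule notE)
    qed
    then show "\<forall>x\<in>set xs. (\<Sum>y\<in>set ys. F x y * f (Some y)) = 0" using f by simp
    show "\<forall>y\<in>set ys. f (Some y) = 0 \<Longrightarrow> \<forall>z\<in>set zs. f z = 0" using f0 by (auto simp: zs_def)
  qed auto
  ultimately show False
    using kernel_dim_transpose[OF acts_as_carrier[OF aA]] kernel_dim_transpose[OF acts_as_carrier[OF aA']]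
    by (simp add: zs_def)
qed

section \<open>The operators of a graph and their intertwiners\<close>

text \<open>
  The arcs are the directed edges of a finite simple graph. The linear order on the vertices
  serves only to choose an orientation of every edge.
\<close>

locale arc_graph =
  fixes V :: "'v :: linorder set" and E :: "('v \<times> 'v) set"
  assumes finV: "finite V"
    and arc_sym: "(i, j) \<in> E \<Longrightarrow> (j, i) \<in> E"
    and arc_irrefl: "(i, i) \<notin> E"
    and arc_tail: "(i, j) \<in> E \<Longrightarrow> i \<in> V"
begin

lemma arc_head: "(i, j) \<in> E \<Longrightarrow> j \<in> V"
  using arc_sym arc_tail by blast

lemma finE: "finite E"
  by (rule finite_subset[of E "V \<times> V"]) (use finV arc_tail arc_head in auto)

definition nbrs :: "'v \<Rightarrow> 'v set" where "nbrs v = {w. (v, w) \<in> E}"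

lemma finite_nbrs [simp]: "finite (nbrs v)"
  using finite_subset[of "nbrs v" V] finV arc_head unfolding nbrs_def by auto

lemma sum_arcs: "(\<Sum>v\<in>V. \<Sum>w\<in>nbrs v. c v w) = (\<Sum>(v, w)\<in>E. c v w)"
proof -
  have "Sigma V nbrs = E" using arc_tail unfolding nbrs_def by auto
  then show ?thesis using sum.Sigma[of V nbrs c] finV by simp
qed

lemma sum_arcs_swap: "(\<Sum>(v, w)\<in>E. c v w) = (\<Sum>(v, w)\<in>E. c w v)"
  by (rule sum.reindex_bij_witness[of _ prod.swap prod.swap]) (auto intro: arc_sym)

definition outsum :: "('v \<times> 'v \<Rightarrow> complex) \<Rightarrow> 'v \<Rightarrow> complex" where
  "outsum f v = (\<Sum>w\<in>nbrs v. f (v, w))"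

definition nb_op :: "('v \<times> 'v \<Rightarrow> complex) \<Rightarrow> 'v \<times> 'v \<Rightarrow> complex" where
  "nb_op f e = outsum f (snd e) - f (prod.swap e)"

text \<open>
  A function on \<^typ>\<open>'v + 'v\<close> is a pair \<open>(x, y)\<close> of functions on the vertices, and the operator
  sends it to \<open>(A x + (D - 1) y, - x)\<close>.
\<close>

definition K_op :: "('v + 'v \<Rightarrow> complex) \<Rightarrow> 'v + 'v \<Rightarrow> complex" where
  "K_op f = case_sum
     (\<lambda>v. (\<Sum>w\<in>nbrs v. f (Inl w)) + (of_nat (card (nbrs v)) - 1) * f (Inr v))
     (\<lambda>v. - f (Inl v))"

text \<open>
  Write \<open>P\<close> for the sum over the arcs that leave a vertex, \<open>\<tau>\<close> for the reversal of arcs, \<open>T x\<close>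
  for the function that reads \<open>x\<close> at the head of an arc and \<open>U x\<close> for the one that reads it at
  the tail. Then the non-backtracking operator is \<open>T P - \<tau>\<close>, and the two intertwiners are
  \<open>R (x, y) = T x + U y\<close> and \<open>Q f = (A P f - P \<tau> f, - P f)\<close>. The four identities that follow
  come from \<open>P T = A\<close>, \<open>P U = D\<close>, \<open>\<tau> T = U\<close> and \<open>\<tau>^2 = 1\<close>.
\<close>

definition R_op :: "('v + 'v \<Rightarrow> complex) \<Rightarrow> 'v \<times> 'v \<Rightarrow> complex" where
  "R_op f e = f (Inl (snd e)) + f (Inr (fst e))"

definition Q_op :: "('v \<times> 'v \<Rightarrow> complex) \<Rightarrow> 'v + 'v \<Rightarrow> complex" where
  "Q_op f = case_sum
     (\<lambda>v. (\<Sum>w\<in>nbrs v. outsum f w) - (\<Sum>w\<in>nbrs v. f (w, v)))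
     (\<lambda>v. - outsum f v)"

lemma nb_R: "nb_op (R_op f) e = R_op (K_op f) e"
  by (cases e) (simp add: nb_op_def R_op_def K_op_def outsum_def sum.distrib algebra_simps)

lemma outsum_nb: "outsum (nb_op f) v = (\<Sum>w\<in>nbrs v. outsum f w) - (\<Sum>w\<in>nbrs v. f (w, v))"
  by (simp add: nb_op_def outsum_def sum_subtractf)

lemma Q_nb: "Q_op (nb_op f) x = K_op (Q_op f) x"
proof (cases x)
  case (Inl v)
  have 1: "(\<Sum>w\<in>nbrs v. nb_op f (w, v)) = of_nat (card (nbrs v)) * outsum f v - outsum f v"
    by (simp add: nb_op_def sum_subtractf) (simp add: outsum_def)
  show ?thesis unfolding Inl K_op_def Q_op_def sum.case 1 outsum_nb by (simp add: algebra_simps)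
next
  case (Inr v)
  then show ?thesis by (simp add: Q_op_def K_op_def outsum_nb)
qed

lemma Q_R: "Q_op (R_op f) x = K_op (K_op f) x - f x"
proof -
  have 1: "outsum (R_op f) v = (\<Sum>w\<in>nbrs v. f (Inl w)) + of_nat (card (nbrs v)) * f (Inr v)" for v
    by (simp add: outsum_def R_op_def sum.distrib)
  have 2: "(\<Sum>w\<in>nbrs v. R_op f (w, v)) = of_nat (card (nbrs v)) * f (Inl v) + (\<Sum>w\<in>nbrs v. f (Inr w))" for v
    by (simp add: R_op_def sum.distrib)
  show ?thesis
    by (cases x) (simp_all add: Q_op_def 1 2, simp_all add: K_op_def sum.distrib sum_subtractf algebra_simps)
qed

lemma R_Q: "R_op (Q_op f) e = nb_op (nb_op f) e - f e"
proof -
  have "nb_op (nb_op f) e = outsum (nb_op f) (snd e) - nb_op f (prod.swap e)" by (simp add: nb_op_def)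
  then show ?thesis
    unfolding outsum_nb by (cases e) (simp add: R_op_def Q_op_def nb_op_def)
qed

section \<open>The incidence operators\<close>

definition oarcs :: "('v \<times> 'v) set" where "oarcs = {(i, j) \<in> E. i < j}"

text \<open>
  Functions on the edges, oriented by the order of the vertices, correspond to functions on the
  arcs that are multiplied by \<open>- \<epsilon>\<close> when the arc is reversed: antisymmetric ones for \<open>\<epsilon> = 1\<close>,
  symmetric ones for \<open>\<epsilon> = -1\<close>. Under this identification the outgoing sum becomes the signed
  (\<open>\<epsilon> = 1\<close>) or unsigned (\<open>\<epsilon> = -1\<close>) incidence matrix.
\<close>

definition alt_ext :: "complex \<Rightarrow> ('v \<times> 'v \<Rightarrow> complex) \<Rightarrow> 'v \<times> 'v \<Rightarrow> complex" where
  "alt_ext \<epsilon> g = (\<lambda>(i, j). if i < j then g (i, j) else - \<epsilon> * g (j, i))"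

definition incidence :: "complex \<Rightarrow> 'v \<Rightarrow> 'v \<times> 'v \<Rightarrow> complex" where
  "incidence \<epsilon> v e = (if fst e = v then 1 else 0) - \<epsilon> * (if snd e = v then 1 else 0)"

lemma fin_oarcs [simp]: "finite oarcs"
  using finE by (rule finite_subset[rotated]) (auto simp: oarcs_def)

lemma arcs_as_oarcs: "E = oarcs \<union> prod.swap ` oarcs" "oarcs \<inter> prod.swap ` oarcs = {}"
proof -
  have "e \<in> oarcs \<union> prod.swap ` oarcs" if "e \<in> E" for e
  proof (cases e)
    case (Pair i j)
    with that have ij: "(i, j) \<in> E" "(j, i) \<in> E" "i \<noteq> j" using arc_sym arc_irrefl by auto
    show ?thesis
    proof (cases "i < j")
      case True
      then show ?thesis using ij Pair by (simp add: oarcs_def)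
    next
      case False
      then have "(j, i) \<in> oarcs" using ij by (simp add: oarcs_def)
      then have "prod.swap (j, i) \<in> prod.swap ` oarcs" by (rule imageI)
      then show ?thesis using Pair by simp
    qed
  qed
  moreover have "oarcs \<union> prod.swap ` oarcs \<subseteq> E" using arc_sym by (auto simp: oarcs_def)
  ultimately show "E = oarcs \<union> prod.swap ` oarcs" by blast
  show "oarcs \<inter> prod.swap ` oarcs = {}" by (auto simp: oarcs_def)
qed

lemma card_arcs: "card E = 2 * card oarcs"
proof -
  have "card (prod.swap ` oarcs) = card oarcs" by (rule card_image) simp
  then show ?thesis using arcs_as_oarcs by (metis card_Un_disjoint fin_oarcs finite_imageI mult_2)
qed

lemma outsum_alt_ext: "outsum (alt_ext \<epsilon> g) v = (\<Sum>e\<in>oarcs. incidence \<epsilon> v e * g e)"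
proof -
  let ?S = "{e \<in> oarcs. fst e = v}" and ?T = "{e \<in> oarcs. snd e = v}"
  have split: "nbrs v = {w. (v, w) \<in> oarcs} \<union> {w. (w, v) \<in> oarcs}"
  proof (rule Set.set_eqI)
    fix w
    show "w \<in> nbrs v \<longleftrightarrow> w \<in> {w. (v, w) \<in> oarcs} \<union> {w. (w, v) \<in> oarcs}"
      using arc_irrefl[of v] arc_sym[of v w] arc_sym[of w v]
      by (cases v w rule: linorder_cases) (simp_all add: nbrs_def oarcs_def, blast+)
  qed
  have fin: "finite {w. (v, w) \<in> oarcs}" "finite {w. (w, v) \<in> oarcs}"
    by (rule finite_subset[OF _ finite_nbrs[of v]], auto simp: split)+
  have "outsum (alt_ext \<epsilon> g) v
      = (\<Sum>w | (v, w) \<in> oarcs. alt_ext \<epsilon> g (v, w)) + (\<Sum>w | (w, v) \<in> oarcs. alt_ext \<epsilon> g (v, w))"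
    unfolding outsum_def split by (rule sum.union_disjoint) (use fin in \<open>auto simp: oarcs_def\<close>)
  also have "(\<Sum>w | (v, w) \<in> oarcs. alt_ext \<epsilon> g (v, w)) = (\<Sum>e\<in>?S. g e)"
    by (rule sum.reindex_bij_witness[of _ snd "\<lambda>w. (v, w)"]) (auto simp: oarcs_def alt_ext_def)
  also have "(\<Sum>w | (w, v) \<in> oarcs. alt_ext \<epsilon> g (v, w)) = (\<Sum>e\<in>?T. - \<epsilon> * g e)"
    by (rule sum.reindex_bij_witness[of _ fst "\<lambda>w. (w, v)"]) (auto simp: oarcs_def alt_ext_def)
  also have "(\<Sum>e\<in>?S. g e) = (\<Sum>e\<in>oarcs. (if fst e = v then 1 else 0) * g e)"
    by (simp add: sum.inter_filter[symmetric] if_distrib[of "\<lambda>c. c * _"] cong: if_cong)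
  also have "(\<Sum>e\<in>?T. - \<epsilon> * g e) = (\<Sum>e\<in>oarcs. - \<epsilon> * (if snd e = v then 1 else 0) * g e)"
    by (simp add: sum.inter_filter[symmetric] if_distrib[of "\<lambda>c. c * _"] if_distrib[of "\<lambda>c. _ * c"] cong: if_cong)
  finally show ?thesis by (simp add: incidence_def algebra_simps sum.distrib sum_subtractf sum_negf)
qed

lemma incidence_transpose:
  assumes "e \<in> E"
  shows "(\<Sum>v\<in>V. incidence \<epsilon> v e * x v) = x (fst e) - \<epsilon> * x (snd e)"
proof -
  have "fst e \<in> V" "snd e \<in> V" using assms arc_tail arc_head by (metis prod.collapse)+
  then show ?thesis using finV
    by (simp add: incidence_def left_diff_distrib sum_subtractf if_distrib[of "\<lambda>c. c * _"] 
        if_distrib[of "\<lambda>c. _ * c"] mult.assoc cong: if_cong)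
qed

text \<open>
  The left kernel of the incidence matrix: locally constant functions for \<open>\<epsilon> = 1\<close>, functions
  that alternate in sign along every edge for \<open>\<epsilon> = -1\<close>. In a connected graph the latter exist,
  apart from \<open>0\<close>, exactly when the graph is bipartite.
\<close>

definition twisted_const :: "complex \<Rightarrow> ('v \<Rightarrow> complex) \<Rightarrow> bool" where
  "twisted_const \<epsilon> x \<longleftrightarrow> (\<forall>(i, j)\<in>E. x i = \<epsilon> * x j)"

lemma twisted_constD: "twisted_const \<epsilon> x \<Longrightarrow> (i, j) \<in> E \<Longrightarrow> x i = \<epsilon> * x j"
  by (auto simp: twisted_const_def)

lemma twisted_const_oarcs:
  assumes "\<epsilon> * \<epsilon> = 1"
  shows "twisted_const \<epsilon> x \<longleftrightarrow> (\<forall>e\<in>oarcs. x (fst e) - \<epsilon> * x (snd e) = 0)"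
proof
  assume "twisted_const \<epsilon> x"
  then show "\<forall>e\<in>oarcs. x (fst e) - \<epsilon> * x (snd e) = 0"
    by (auto simp: oarcs_def dest: twisted_constD)
next
  assume o: "\<forall>e\<in>oarcs. x (fst e) - \<epsilon> * x (snd e) = 0"
  have "x i = \<epsilon> * x j" if "(i, j) \<in> E" for i j
  proof (cases "(i, j) \<in> oarcs")
    case True
    then show ?thesis using o by force
  next
    case False
    then have "(j, i) \<in> oarcs" using that arcs_as_oarcs(1) by force
    then have "x j = \<epsilon> * x i" using o by force
    then show ?thesis using assms by (simp flip: mult.assoc)
  qed
  then show "twisted_const \<epsilon> x" unfolding twisted_const_def by auto
qed

text \<open>
  A function that is harmonic for the Laplacian (\<open>\<epsilon> = 1\<close>) or the signless Laplacian (\<open>\<epsilon> = -1\<close>)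
  has energy \<open>\<Sum> |x v - \<epsilon> x w|^2 = 0\<close>, summed over all arcs \<open>(v, w)\<close>.
\<close>

lemma harmonic_imp_twisted_const:
  assumes eps: "\<epsilon> = 1 \<or> \<epsilon> = -1"
    and harm: "\<And>v. v \<in> V \<Longrightarrow> (\<Sum>w\<in>nbrs v. x w - \<epsilon> * x v) = 0"
  shows "twisted_const \<epsilon> x"
proof -
  have epsc: "cnj \<epsilon> = \<epsilon>" using eps by auto
  let ?d = "\<lambda>v w. x v - \<epsilon> * x w"
  have d: "- \<epsilon> * ?d w v = ?d v w" for v w using eps by (auto simp: algebra_simps)
  have s1: "(\<Sum>(v, w)\<in>E. cnj (x v) * ?d v w) = 0"
  proof -
    have "(\<Sum>w\<in>nbrs v. cnj (x v) * ?d v w) = - cnj (x v) * \<epsilon> * (\<Sum>w\<in>nbrs v. x w - \<epsilon> * x v)" for v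
      unfolding sum_distrib_left using eps by (intro sum.cong refl) (auto simp: algebra_simps)
    then show ?thesis unfolding sum_arcs[symmetric] using harm by simp
  qed
  have "(\<Sum>(v, w)\<in>E. ?d v w * cnj (?d v w))
      = (\<Sum>(v, w)\<in>E. cnj (x v) * ?d v w) + (\<Sum>(v, w)\<in>E. cnj (x w) * (- \<epsilon> * ?d v w))"
    unfolding sum.distrib[symmetric] by (intro sum.cong) (auto simp: epsc algebra_simps)
  also have "(\<Sum>(v, w)\<in>E. cnj (x w) * (- \<epsilon> * ?d v w)) = (\<Sum>(v, w)\<in>E. cnj (x w) * ?d w v)"
    unfolding d ..
  also have "\<dots> = (\<Sum>(v, w)\<in>E. cnj (x v) * ?d v w)"
    by (rule sum_arcs_swap)
  finally have "(\<Sum>(v, w)\<in>E. ?d v w * cnj (?d v w)) = 0" using s1 by simp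
  moreover have "complex_of_real (\<Sum>(v, w)\<in>E. (cmod (?d v w))\<^sup>2) = (\<Sum>(v, w)\<in>E. ?d v w * cnj (?d v w))"
    unfolding of_real_sum by (intro sum.cong refl) (simp only: complex_norm_square case_prod_unfold)
  ultimately have "complex_of_real (\<Sum>(v, w)\<in>E. (cmod (?d v w))\<^sup>2) = 0" by simp
  then have "(\<Sum>(v, w)\<in>E. (cmod (?d v w))\<^sup>2) = 0" by (simp only: of_real_eq_0_iff)
  then have "\<forall>e\<in>E. (case e of (v, w) \<Rightarrow> (cmod (?d v w))\<^sup>2) = 0"
    by (subst (asm) sum_nonneg_eq_0_iff) (use finE in \<open>auto simp: case_prod_unfold\<close>)
  then show ?thesis unfolding twisted_const_def by auto
qed

end

section \<open>The eigenvalues 1 and -1\<close>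

context arc_graph begin

text \<open>
  The form in which connectedness enters the linear algebra.
\<close>

definition adj_connected :: bool where
  "adj_connected \<longleftrightarrow> (\<forall>c :: 'v \<Rightarrow> complex. (\<forall>(i, j)\<in>E. c i = c j) \<longrightarrow> (\<forall>i\<in>V. \<forall>j\<in>V. c i = c j))"

text \<open>
  The factors \<open>\<epsilon>\<close> that the two functions pick up along an edge cancel in their product.
\<close>

lemma twisted_const_prod_const:
  assumes "adj_connected" "\<epsilon> * \<epsilon> = 1" "twisted_const \<epsilon> x" "twisted_const \<epsilon> y"
  obtains c where "\<And>v. v \<in> V \<Longrightarrow> x v * y v = c"
proof -
  have "\<forall>(i, j)\<in>E. x i * y i = x j * y j"
  proof (clarify)
    fix i j assume ij: "(i, j) \<in> E"
    have "x i * y i = (\<epsilon> * x j) * (\<epsilon> * y j)"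
      by (simp only: twisted_constD[OF assms(3) ij] twisted_constD[OF assms(4) ij])
    also have "\<dots> = (\<epsilon> * \<epsilon>) * (x j * y j)" by (simp only: ac_simps)
    finally show "x i * y i = x j * y j" using assms(2) by simp
  qed
  then have *: "\<forall>i\<in>V. \<forall>j\<in>V. x i * y i = x j * y j"
    using assms(1)[unfolded adj_connected_def, THEN spec[of _ "\<lambda>v. x v * y v"]] by blast
  show ?thesis
  proof (cases "V = {}")
    case False
    then obtain u where "u \<in> V" by auto
    then show ?thesis using * that[of "x u * y u"] by blast
  qed (use that in auto)
qed

lemma sum_card_nbrs: "(\<Sum>v\<in>V. of_nat (card (nbrs v))) = (of_nat (2 * card oarcs) :: complex)"
  using sum_arcs[of "\<lambda>_ _. 1 :: complex"] card_arcs by simp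

lemma nb_eigen_eq:
  assumes "\<And>e. e \<in> E \<Longrightarrow> nb_op f e = \<epsilon> * f e" "(i, j) \<in> E"
  shows "outsum f j = f (j, i) + \<epsilon> * f (i, j)"
  using assms(1)[OF assms(2)] by (simp add: nb_op_def algebra_simps)

lemma nb_eigen_outsum_twisted_const:
  assumes eps: "\<epsilon> * \<epsilon> = 1" and eig: "\<And>e. e \<in> E \<Longrightarrow> nb_op f e = \<epsilon> * f e"
  shows "twisted_const \<epsilon> (outsum f)"
  unfolding twisted_const_def
proof clarify
  fix i j assume ij: "(i, j) \<in> E"
  have "outsum f i = f (i, j) + \<epsilon> * f (j, i)" by (rule nb_eigen_eq[OF eig arc_sym[OF ij]])
  also have "\<dots> = \<epsilon> * (f (j, i) + \<epsilon> * f (i, j))" using eps by (simp add: distrib_left mult.assoc[symmetric])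
  also have "f (j, i) + \<epsilon> * f (i, j) = outsum f j" by (rule nb_eigen_eq[OF eig ij, symmetric])
  finally show "outsum f i = \<epsilon> * outsum f j" .
qed

text \<open>
  The two ways in which the obstruction at \<open>\<epsilon>\<close> can disappear: the numbers of edges and vertices
  differ, or there is no nonzero twisted constant function. In all other cases the Jordan blocks
  for \<open>\<epsilon>\<close> differ.
\<close>

definition no_defect :: "complex \<Rightarrow> bool" where
  "no_defect \<epsilon> \<longleftrightarrow> card oarcs \<noteq> card V \<or> (\<forall>x. twisted_const \<epsilon> x \<longrightarrow> (\<forall>v\<in>V. x v = 0))"

text \<open>
  The defect computations end with a twisted constant function \<open>x\<close> whose square is the constant
  \<open>c\<close> and with the equation \<open>(m - n) c = 0\<close>, where \<open>m\<close> and \<open>n\<close> count edges and vertices.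
\<close>

lemma twisted_const_square_zero:
  assumes x: "twisted_const \<epsilon> x"
    and sum0: "(of_nat (card oarcs) - of_nat (card V)) * c = 0"
    and c: "\<And>v. v \<in> V \<Longrightarrow> x v * x v = c"
    and nd: "no_defect \<epsilon>" and v: "v \<in> V"
  shows "x v = 0"
proof (cases "card oarcs = card V")
  case True
  then show ?thesis using nd x v unfolding no_defect_def by blast
next
  case False
  then have "of_nat (card oarcs) - of_nat (card V) \<noteq> (0 :: complex)" by simp
  then have "c = 0" using sum0 by simp
  then show ?thesis using c[OF v] by simp
qed

text \<open>
  Let \<open>g\<close> be the outgoing sum of the eigenvector \<open>f\<close>. It is twisted constant, so \<open>g^2 = c\<close>. The
  sum of \<open>f (i, j) g i\<close> over all arcs is \<open>n c\<close> when it is grouped by the tail, and \<open>m c\<close> when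
  each arc is paired with its reversal, because \<open>f (i, j) g i + f (j, i) g j = c\<close>. Hence
  \<open>(m - n) c = 0\<close>.
\<close>

lemma nb_eigen_outsum_zero:
  assumes conn: "adj_connected" and eps: "\<epsilon> * \<epsilon> = 1" and nd: "no_defect \<epsilon>"
    and eig: "\<And>e. e \<in> E \<Longrightarrow> nb_op f e = \<epsilon> * f e" and v: "v \<in> V"
  shows "outsum f v = 0"
proof -
  let ?g = "outsum f"
  have tw: "twisted_const \<epsilon> ?g" by (rule nb_eigen_outsum_twisted_const[OF eps eig])
  obtain c where c: "\<And>v. v \<in> V \<Longrightarrow> ?g v * ?g v = c"
    using twisted_const_prod_const[OF conn eps tw tw] by blast
  have "(\<Sum>(i, j)\<in>E. f (i, j) * ?g i) = (\<Sum>v\<in>V. ?g v * ?g v)"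
    unfolding sum_arcs[symmetric] outsum_def by (simp add: sum_distrib_right)
  also have "\<dots> = of_nat (card V) * c" using c by simp
  finally have s: "(\<Sum>(i, j)\<in>E. f (i, j) * ?g i) = of_nat (card V) * c" .
  have "(\<Sum>(i, j)\<in>E. f (i, j) * ?g i + f (j, i) * ?g j) = (\<Sum>(i, j)\<in>E. c)"
  proof (rule sum.cong[OF refl], clarify)
    fix i j assume ij: "(i, j) \<in> E"
    have eq: "?g j = f (j, i) + \<epsilon> * f (i, j)" by (rule nb_eigen_eq[OF eig ij])
    have "f (i, j) * ?g i + f (j, i) * ?g j = (f (j, i) + \<epsilon> * f (i, j)) * ?g j"
      unfolding twisted_constD[OF tw ij] by (simp add: algebra_simps)
    also have "\<dots> = c" unfolding eq[symmetric] by (rule c[OF arc_head[OF ij]])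
    finally show "f (i, j) * ?g i + f (j, i) * ?g j = c" .
  qed
  moreover have "(\<Sum>(i, j)\<in>E. f (i, j) * ?g i + f (j, i) * ?g j)
      = (\<Sum>(i, j)\<in>E. f (i, j) * ?g i) + (\<Sum>(i, j)\<in>E. f (j, i) * ?g j)"
    by (simp add: sum.distrib case_prod_unfold)
  moreover have "(\<Sum>(i, j)\<in>E. f (j, i) * ?g j) = (\<Sum>(i, j)\<in>E. f (i, j) * ?g i)"
    by (rule sum_arcs_swap)
  ultimately have "2 * (of_nat (card V) * c) = of_nat (card E) * c" using s by (simp add: case_prod_unfold)
  then have "2 * ((of_nat (card oarcs) - of_nat (card V)) * c) = 0"
    unfolding card_arcs by (auto simp: algebra_simps)
  then have "(of_nat (card oarcs) - of_nat (card V)) * c = 0" by (metis mult_eq_0_iff zero_neq_numeral)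
  from twisted_const_square_zero[OF tw this c nd v] show ?thesis by simp
qed

lemma nb_eigen_twisted:
  assumes eig: "\<And>e. e \<in> E \<Longrightarrow> nb_op f e = \<epsilon> * f e" and 0: "outsum f j = 0" and ij: "(i, j) \<in> E"
  shows "f (j, i) = - \<epsilon> * f (i, j)"
  using nb_eigen_eq[OF eig ij] 0 by (simp add: eq_neg_iff_add_eq_0)

text \<open>
  For \<open>h = (B - \<epsilon>) f\<close> in the eigenspace, comparing the values at an arc and at its reversal
  gives \<open>2 h (i, j) = g j - \<epsilon> g i\<close> with \<open>g\<close> the outgoing sum of \<open>f\<close>. Since the outgoing sums of
  \<open>h\<close> vanish, \<open>g\<close> is harmonic, hence twisted constant, and \<open>h = 0\<close>.
\<close>

lemma nb_no_generalised_eigenvector: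
  assumes conn: "adj_connected" and eps: "\<epsilon> = 1 \<or> \<epsilon> = -1" and nd: "no_defect \<epsilon>"
    and h: "\<And>e. e \<in> E \<Longrightarrow> nb_op f e - \<epsilon> * f e = h e"
    and eig: "\<And>e. e \<in> E \<Longrightarrow> nb_op h e = \<epsilon> * h e" and e: "e \<in> E"
  shows "h e = 0"
proof -
  have eps2: "\<epsilon> * \<epsilon> = 1" using eps by auto
  let ?g = "outsum f"
  have h0: "outsum h v = 0" if "v \<in> V" for v
    using nb_eigen_outsum_zero[OF conn eps2 nd eig that] .
  have 2: "2 * h (i, j) = ?g j - \<epsilon> * ?g i" if ij: "(i, j) \<in> E" for i j
  proof -
    have "h (j, i) = - \<epsilon> * h (i, j)" by (rule nb_eigen_twisted[OF eig h0[OF arc_head[OF ij]] ij])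
    then have "- \<epsilon> * h (i, j) = ?g i - f (i, j) - \<epsilon> * f (j, i)"
      using h[OF arc_sym[OF ij]] by (simp add: nb_op_def)
    then have a: "h (i, j) = - \<epsilon> * ?g i + \<epsilon> * f (i, j) + f (j, i)"
      using eps by (auto simp: algebra_simps)
    have b: "h (i, j) = ?g j - f (j, i) - \<epsilon> * f (i, j)"
      using h[OF ij] by (simp add: nb_op_def)
    have "2 * h (i, j) = (- \<epsilon> * ?g i + \<epsilon> * f (i, j) + f (j, i)) + (?g j - f (j, i) - \<epsilon> * f (i, j))"
      unfolding mult_2 by (rule arg_cong2[OF a b, of "(+)"])
    also have "\<dots> = ?g j - \<epsilon> * ?g i" by simp
    finally show ?thesis .
  qed
  have "twisted_const \<epsilon> ?g"
  proof (rule harmonic_imp_twisted_const[OF eps])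
    fix v assume v: "v \<in> V"
    have "(\<Sum>w\<in>nbrs v. ?g w - \<epsilon> * ?g v) = (\<Sum>w\<in>nbrs v. 2 * h (v, w))"
      using 2 by (intro sum.cong) (auto simp: nbrs_def)
    also have "\<dots> = 2 * outsum h v" by (simp add: outsum_def sum_distrib_left)
    finally show "(\<Sum>w\<in>nbrs v. ?g w - \<epsilon> * ?g v) = 0" using h0[OF v] by simp
  qed
  obtain i j where ij: "e = (i, j)" "(i, j) \<in> E" using e by (cases e) auto
  have "?g j = \<epsilon> * ?g i" using twisted_constD[OF \<open>twisted_const \<epsilon> ?g\<close> arc_sym[OF ij(2)]] .
  then show ?thesis using 2[OF ij(2)] ij by simp
qed

text \<open>
  The second component of the eigenvalue equation gives \<open>y = - \<epsilon> x\<close>; the first one then says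
  that \<open>x\<close> is harmonic.
\<close>

lemma K_eigen_iff:
  assumes eps: "\<epsilon> = 1 \<or> \<epsilon> = -1"
  shows "(\<forall>x\<in>Inl ` V \<union> Inr ` V. K_op f x - \<epsilon> * f x = 0) \<longleftrightarrow>
    twisted_const \<epsilon> (\<lambda>v. f (Inl v)) \<and> (\<forall>v\<in>V. f (Inr v) = - \<epsilon> * f (Inl v))"
proof -
  have Inr_iff: "K_op f (Inr v) - \<epsilon> * f (Inr v) = 0 \<longleftrightarrow> f (Inr v) = - \<epsilon> * f (Inl v)" for v
    using eps by (elim disjE) (auto simp: K_op_def algebra_simps add_eq_0_iff)
  have Inl_eq: "K_op f (Inl v) - \<epsilon> * f (Inl v) = (\<Sum>w\<in>nbrs v. f (Inl w) - \<epsilon> * f (Inl v))"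
    if "f (Inr v) = - \<epsilon> * f (Inl v)" for v
    using that by (simp add: K_op_def sum_subtractf algebra_simps)
  show ?thesis
  proof
    assume z: "\<forall>x\<in>Inl ` V \<union> Inr ` V. K_op f x - \<epsilon> * f x = 0"
    then have r: "\<forall>v\<in>V. f (Inr v) = - \<epsilon> * f (Inl v)" using Inr_iff by blast
    moreover have "twisted_const \<epsilon> (\<lambda>v. f (Inl v))"
    proof (rule harmonic_imp_twisted_const[OF eps])
      fix v assume v: "v \<in> V"
      have "K_op f (Inl v) - \<epsilon> * f (Inl v) = 0" using z v by blast
      then show "(\<Sum>w\<in>nbrs v. f (Inl w) - \<epsilon> * f (Inl v)) = 0"
        unfolding Inl_eq[OF bspec[OF r v]] .
    qed
    ultimately show "twisted_const \<epsilon> (\<lambda>v. f (Inl v)) \<and> (\<forall>v\<in>V. f (Inr v) = - \<epsilon> * f (Inl v))" by blast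
  next
    assume a: "twisted_const \<epsilon> (\<lambda>v. f (Inl v)) \<and> (\<forall>v\<in>V. f (Inr v) = - \<epsilon> * f (Inl v))"
    then have "(\<Sum>w\<in>nbrs v. f (Inl w) - \<epsilon> * f (Inl v)) = 0" for v
      by (intro sum.neutral) (auto simp: nbrs_def dest: arc_sym twisted_constD)
    then show "\<forall>x\<in>Inl ` V \<union> Inr ` V. K_op f x - \<epsilon> * f x = 0"
      using a Inl_eq Inr_iff by auto
  qed
qed

text \<open>
  Suppose \<open>(K - \<epsilon>) (y, _) = (\<sigma>, - \<epsilon> \<sigma>)\<close>. Eliminating the second component gives
  \<open>\<Sum>w. y w - \<epsilon> y v = (2 - deg v) \<sigma> v\<close>, the sum being over the neighbours \<open>w\<close> of \<open>v\<close>. Pairing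
  with \<open>\<sigma>\<close> kills the left-hand side, and the right-hand side becomes \<open>2 (n - m) c\<close> with
  \<open>\<sigma>^2 = c\<close>.
\<close>

lemma K_no_generalised_eigenvector:
  assumes conn: "adj_connected" and eps: "\<epsilon> = 1 \<or> \<epsilon> = -1" and nd: "no_defect \<epsilon>"
    and h: "\<And>x. x \<in> Inl ` V \<union> Inr ` V \<Longrightarrow> K_op f x - \<epsilon> * f x = h x"
    and eig: "\<And>x. x \<in> Inl ` V \<union> Inr ` V \<Longrightarrow> K_op h x - \<epsilon> * h x = 0"
    and x: "x \<in> Inl ` V \<union> Inr ` V"
  shows "h x = 0"
proof -
  have eps2: "\<epsilon> * \<epsilon> = 1" using eps by auto
  define \<sigma> where "\<sigma> v = h (Inl v)" for v
  define y where "y v = f (Inl v)" for v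
  have tw: "twisted_const \<epsilon> \<sigma>" and hr: "\<And>v. v \<in> V \<Longrightarrow> h (Inr v) = - \<epsilon> * \<sigma> v"
    using K_eigen_iff[OF eps, of h] eig unfolding \<sigma>_def by auto
  have fr: "f (Inr v) = \<sigma> v - \<epsilon> * y v" if "v \<in> V" for v
  proof -
    have "- y v - \<epsilon> * f (Inr v) = - \<epsilon> * \<sigma> v" using h[of "Inr v"] hr[OF that] that by (simp add: K_op_def y_def)
    then show ?thesis using eps by (auto simp: algebra_simps add_eq_0_iff)
  qed
  have key: "(\<Sum>w\<in>nbrs v. y w - \<epsilon> * y v) = (2 - of_nat (card (nbrs v))) * \<sigma> v" if v: "v \<in> V" for v
  proof -
    have "(\<Sum>w\<in>nbrs v. y w) + (of_nat (card (nbrs v)) - 1) * (\<sigma> v - \<epsilon> * y v) - \<epsilon> * y v = \<sigma> v"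
      using h[of "Inl v"] v fr[OF v] by (simp add: K_op_def y_def \<sigma>_def)
    then show ?thesis by (simp add: sum_subtractf algebra_simps)
  qed
  obtain c where c: "\<And>v. v \<in> V \<Longrightarrow> \<sigma> v * \<sigma> v = c"
    using twisted_const_prod_const[OF conn eps2 tw tw] by blast
  have "(\<Sum>v\<in>V. \<Sum>w\<in>nbrs v. (y w - \<epsilon> * y v) * \<sigma> v) = (\<Sum>v\<in>V. \<Sum>w\<in>nbrs v. y w * \<sigma> v - y v * \<sigma> w)"
  proof (intro sum.cong refl)
    fix v w assume "w \<in> nbrs v"
    then have "\<sigma> w = \<epsilon> * \<sigma> v" unfolding nbrs_def using arc_sym twisted_constD[OF tw] by blast
    then show "(y w - \<epsilon> * y v) * \<sigma> v = y w * \<sigma> v - y v * \<sigma> w" by (simp add: algebra_simps)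
  qed
  also have "\<dots> = (\<Sum>(v, w)\<in>E. y w * \<sigma> v) - (\<Sum>(v, w)\<in>E. y v * \<sigma> w)"
    unfolding sum_arcs by (simp add: sum_subtractf case_prod_unfold)
  also have "(\<Sum>(v, w)\<in>E. y v * \<sigma> w) = (\<Sum>(v, w)\<in>E. y w * \<sigma> v)" by (rule sum_arcs_swap)
  finally have "0 = (\<Sum>v\<in>V. (\<Sum>w\<in>nbrs v. y w - \<epsilon> * y v) * \<sigma> v)"
    by (simp add: sum_distrib_right)
  also have "\<dots> = (\<Sum>v\<in>V. (2 - of_nat (card (nbrs v))) * c)"
    using key c by (intro sum.cong refl) (simp add: mult.assoc)
  also have "\<dots> = (2 * of_nat (card V) - of_nat (2 * card oarcs)) * c"
    unfolding sum_distrib_right[symmetric] sum_subtractf sum_card_nbrs by simp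
  finally have "2 * ((of_nat (card oarcs) - of_nat (card V)) * c) = 0" by (simp add: algebra_simps)
  then have "(of_nat (card oarcs) - of_nat (card V)) * c = 0" by (metis mult_eq_0_iff zero_neq_numeral)
  from twisted_const_square_zero[OF tw this c nd]
  have "\<sigma> v = 0" if "v \<in> V" for v using that by blast
  then show ?thesis using x hr unfolding \<sigma>_def by auto
qed

end

section \<open>Comparison of the two matrices\<close>

text \<open>
  Orders of the vertices, of the oriented edges and of the arcs turn the operators into
  matrices. The order of the arcs is arbitrary, as it is in the non-backtracking matrix.
\<close>

locale enumerated_arc_graph = arc_graph V E for V :: "'v :: linorder set" and E +
  fixes vs :: "'v list" and us es :: "('v \<times> 'v) list" and B K :: "complex mat"
  assumes vs: "distinct vs" "set vs = V"
    and us: "distinct us" "set us = oarcs"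
    and es: "distinct es" "set es = E"
    and B: "acts_as es es B nb_op"
    and K: "acts_as (map Inl vs @ map Inr vs) (map Inl vs @ map Inr vs) K K_op"
    and conn: "adj_connected"
begin

abbreviation ks :: "('v + 'v) list" where "ks \<equiv> map Inl vs @ map Inr vs"

lemma ks: "distinct ks" "set ks = Inl ` V \<union> Inr ` V"
  using vs by (auto simp: distinct_map)

lemma length_vs: "length vs = card V" and length_us: "length us = card oarcs"
  using vs us distinct_card by force+

lemma dim_gen_eigenspace_nb_K:
  assumes "z * z \<noteq> 1"
  shows "dim_gen_eigenspace B z k = dim_gen_eigenspace K z k"
proof -
  define r where "r e = case_sum (\<lambda>v. if snd e = v then 1 else 0 :: complex) (\<lambda>v. if fst e = v then 1 else 0)"
    for e :: "'v \<times> 'v"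
  define R where "R = mat (length es) (length ks) (\<lambda>(i, j). r (es ! i) (ks ! j))"
  have sum_ks: "(\<Sum>x\<in>set ks. c x) = (\<Sum>v\<in>V. c (Inl v)) + (\<Sum>v\<in>V. c (Inr v))" for c :: "_ \<Rightarrow> complex"
    unfolding ks using finV by (subst sum.union_disjoint) (auto simp: sum.reindex)
  have R: "acts_as es ks R R_op"
    unfolding R_def
  proof (rule acts_as_mat[OF ks(1)])
    fix f e assume "e \<in> set es"
    then have "fst e \<in> V" "snd e \<in> V" using es arc_tail arc_head by (metis prod.collapse)+
    then show "R_op f e = (\<Sum>x\<in>set ks. r e x * f x)"
      unfolding sum_ks using finV by (simp add: R_op_def r_def if_distrib[of "\<lambda>c. c * _"] cong: if_cong)
  qed
  \<comment> \<open>The entries of \<open>Q\<close>: an arc contributes to \<open>A P\<close> at the neighbours of its tail and to \<open>P \<tau>\<close> at its head.\<close>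
  define q where "q x e = case_sum
      (\<lambda>v. (if (v, fst e) \<in> E then 1 else 0) - (if snd e = v then 1 else 0 :: complex))
      (\<lambda>v. - (if fst e = v then 1 else 0)) x" for x :: "'v + 'v" and e :: "'v \<times> 'v"
  define Q where "Q = mat (length ks) (length es) (\<lambda>(i, j). q (ks ! i) (es ! j))"
  have out: "outsum f v = (\<Sum>e\<in>E. (if fst e = v then 1 else 0) * f e)" if "v \<in> V" for f v
  proof -
    have "(\<Sum>e\<in>E. (if fst e = v then 1 else 0) * f e) = (\<Sum>u\<in>V. \<Sum>w\<in>nbrs u. (if u = v then 1 else 0) * f (u, w))"
      unfolding sum_arcs by (simp add: case_prod_unfold)
    also have "\<dots> = (\<Sum>u\<in>V. if u = v then outsum f u else 0)"
      by (intro sum.cong refl) (auto simp: outsum_def)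
    finally show ?thesis using that finV by simp
  qed
  have Q: "acts_as ks es Q Q_op"
    unfolding Q_def
  proof (rule acts_as_mat[OF es(1)])
    fix f x assume x: "x \<in> set ks"
    show "Q_op f x = (\<Sum>e\<in>set es. q x e * f e)"
    proof (cases x)
      case (Inl v)
      then have v: "v \<in> V" using x ks by auto
      have "(\<Sum>w\<in>nbrs v. outsum f w) = (\<Sum>e\<in>E. (if (v, fst e) \<in> E then 1 else 0) * f e)"
      proof -
        have "(\<Sum>e\<in>E. (if (v, fst e) \<in> E then 1 else 0) * f e)
            = (\<Sum>u\<in>V. \<Sum>w\<in>nbrs u. (if (v, u) \<in> E then 1 else 0) * f (u, w))"
          unfolding sum_arcs by (simp add: case_prod_unfold)
        also have "\<dots> = (\<Sum>u\<in>V. if u \<in> nbrs v then outsum f u else 0)"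
          by (intro sum.cong refl) (auto simp: outsum_def nbrs_def)
        also have "\<dots> = (\<Sum>u\<in>V \<inter> nbrs v. outsum f u)"
          using finV by (simp add: sum.inter_restrict)
        also have "V \<inter> nbrs v = nbrs v" using arc_head by (auto simp: nbrs_def)
        finally show ?thesis ..
      qed
      moreover have "(\<Sum>w\<in>nbrs v. f (w, v)) = (\<Sum>e\<in>E. (if snd e = v then 1 else 0) * f e)"
      proof -
        have "(\<Sum>w\<in>nbrs v. f (w, v)) = outsum (\<lambda>e. f (prod.swap e)) v" by (simp add: outsum_def)
        also have "\<dots> = (\<Sum>(i, j)\<in>E. (if i = v then 1 else 0) * f (j, i))"
          unfolding out[OF v] by (simp add: case_prod_unfold prod.swap_def)
        also have "\<dots> = (\<Sum>(i, j)\<in>E. (if j = v then 1 else 0) * f (i, j))" by (rule sum_arcs_swap)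
        finally show ?thesis by (simp add: case_prod_unfold)
      qed
      ultimately show ?thesis unfolding Inl es(2)
        by (simp add: Q_op_def q_def left_diff_distrib sum_subtractf)
    next
      case (Inr v)
      then have v: "v \<in> V" using x ks by auto
      then show ?thesis unfolding Inr es(2) by (simp add: Q_op_def q_def out sum_negf)
    qed
  qed
  have cB: "B \<in> carrier_mat (length es) (length es)" and cK: "K \<in> carrier_mat (length ks) (length ks)"
    and cR: "R \<in> carrier_mat (length es) (length ks)" and cQ: "Q \<in> carrier_mat (length ks) (length es)"
    using acts_as_carrier[OF B] acts_as_carrier[OF K] acts_as_carrier[OF R] acts_as_carrier[OF Q] .
  have BR: "B * R = R * K"
    by (rule acts_as_unique[OF ks(1) acts_as_mult[OF B R] acts_as_mult[OF R K]]) (rule nb_R)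
  have KQ: "K * Q = Q * B"
    by (rule acts_as_unique[OF es(1) acts_as_mult[OF K Q] acts_as_mult[OF Q B]]) (rule Q_nb[symmetric])
  have minus1: "X - 1\<^sub>m n = X + (- 1) \<cdot>\<^sub>m 1\<^sub>m n" if "X \<in> carrier_mat n n" for X :: "complex mat" and n
    by (rule eq_matI) (use that in auto)
  have QR: "Q * R = K * K - 1\<^sub>m (length ks)"
    unfolding minus1[OF mult_carrier_mat[OF cK cK]]
    by (rule acts_as_unique[OF ks(1) acts_as_mult[OF Q R] acts_as_add_smult[OF acts_as_mult[OF K K] acts_as_one]])
      (simp add: Q_R)
  have RQ: "R * Q = B * B - 1\<^sub>m (length es)"
    unfolding minus1[OF mult_carrier_mat[OF cB cB]]
    by (rule acts_as_unique[OF es(1) acts_as_mult[OF R Q] acts_as_add_smult[OF acts_as_mult[OF B B] acts_as_one]])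
      (simp add: R_Q)
  show ?thesis
    using dim_gen_eigenspace_le[OF cB cK cR cQ BR QR assms] dim_gen_eigenspace_le[OF cK cB cQ cR KQ RQ assms]
    by (rule antisym[rotated])
qed

definition inc_mat :: "complex \<Rightarrow> complex mat" where
  "inc_mat \<epsilon> = mat (length vs) (length us) (\<lambda>(i, j). incidence \<epsilon> (vs ! i) (us ! j))"

lemma inc_mat: "acts_as vs us (inc_mat \<epsilon>) (\<lambda>g. outsum (alt_ext \<epsilon> g))"
  unfolding inc_mat_def by (rule acts_as_mat) (use us outsum_alt_ext in auto)

lemma inc_mat_transpose: "acts_as us vs (inc_mat \<epsilon>)\<^sup>T (\<lambda>x e. x (fst e) - \<epsilon> * x (snd e))"
proof -
  have T: "(inc_mat \<epsilon>)\<^sup>T = mat (length us) (length vs) (\<lambda>(i, j). incidence \<epsilon> (vs ! j) (us ! i))"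
    by (auto simp: inc_mat_def)
  show ?thesis unfolding T
  proof (rule acts_as_mat[OF vs(1), where F = "\<lambda>e v. incidence \<epsilon> v e"])
    fix x e assume "e \<in> set us"
    then have "e \<in> E" using us by (auto simp: oarcs_def)
    then show "x (fst e) - \<epsilon> * x (snd e) = (\<Sum>v\<in>set vs. incidence \<epsilon> v e * x v)"
      unfolding vs(2) by (rule incidence_transpose[symmetric])
  qed
qed

lemma kernel_dim_inc_mat: "kernel_dim (inc_mat \<epsilon>) + card V = kernel_dim (inc_mat \<epsilon>)\<^sup>T + card oarcs"
  using kernel_dim_transpose[OF acts_as_carrier[OF inc_mat]] length_vs length_us by simp

lemma alt_ext_swap:
  assumes "\<epsilon> * \<epsilon> = 1" "(i, j) \<in> E"
  shows "alt_ext \<epsilon> g (j, i) = - \<epsilon> * alt_ext \<epsilon> g (i, j)"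
proof -
  have "i \<noteq> j" using assms arc_irrefl by auto
  then show ?thesis using assms(1) by (auto simp: alt_ext_def not_less mult.assoc[symmetric])
qed

lemma nb_alt_ext:
  assumes eps: "\<epsilon> * \<epsilon> = 1" and g: "\<forall>v\<in>set vs. outsum (alt_ext \<epsilon> g) v = 0"
  shows "\<forall>e\<in>set es. nb_op (alt_ext \<epsilon> g) e - \<epsilon> * alt_ext \<epsilon> g e = 0"
proof
  fix e assume "e \<in> set es"
  then obtain i j where e: "e = (i, j)" "(i, j) \<in> E" using es by (metis surj_pair)
  then show "nb_op (alt_ext \<epsilon> g) e - \<epsilon> * alt_ext \<epsilon> g e = 0"
    using g vs arc_head[OF e(2)] alt_ext_swap[OF eps e(2)] by (simp add: nb_op_def)
qed

lemma alt_ext_add: "alt_ext \<epsilon> (\<lambda>y. f y + g y) = (\<lambda>y. alt_ext \<epsilon> f y + alt_ext \<epsilon> g y)"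
  and alt_ext_smult: "alt_ext \<epsilon> (\<lambda>y. a * f y) = (\<lambda>y. a * alt_ext \<epsilon> f y)"
  by (auto simp: alt_ext_def algebra_simps)

lemma alt_ext_inj: "\<forall>e\<in>set es. alt_ext \<epsilon> g e = 0 \<Longrightarrow> \<forall>e\<in>set us. g e = 0"
  unfolding us(2) es(2) by (auto simp: oarcs_def alt_ext_def)

lemma kernel_dim_inc_le: 
  assumes eps: "\<epsilon> * \<epsilon> = 1"
  shows "kernel_dim (inc_mat \<epsilon>) \<le> kernel_dim (char_matrix B \<epsilon>)"
  by (rule kernel_dim_mono(1)[OF us(1) es(1) inc_mat acts_as_char_matrix[OF B], of "alt_ext \<epsilon>"])
    (use nb_alt_ext[OF eps] alt_ext_inj in \<open>simp_all add: alt_ext_add alt_ext_smult\<close>)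

text \<open>
  Outgoing sums of eigenvectors vanish, so an eigenvector is multiplied by \<open>- \<epsilon>\<close> under reversal
  and is determined by its values on the oriented edges.
\<close>

lemma kernel_dim_nb_eq:
  assumes eps: "\<epsilon> = 1 \<or> \<epsilon> = -1" and nd: "no_defect \<epsilon>"
  shows "kernel_dim (char_matrix B \<epsilon>) = kernel_dim (inc_mat \<epsilon>)"
proof (rule antisym)
  have eps2: "\<epsilon> * \<epsilon> = 1" using eps by auto
  then show "kernel_dim (inc_mat \<epsilon>) \<le> kernel_dim (char_matrix B \<epsilon>)" by (rule kernel_dim_inc_le)
  show "kernel_dim (char_matrix B \<epsilon>) \<le> kernel_dim (inc_mat \<epsilon>)"
  proof (rule kernel_dim_mono(1)[OF es(1) us(1) acts_as_char_matrix[OF B] inc_mat, of "\<lambda>f. f"])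
    fix f assume f: "\<forall>e\<in>set es. nb_op f e - \<epsilon> * f e = 0"
    then have eig: "\<And>e. e \<in> E \<Longrightarrow> nb_op f e = \<epsilon> * f e" using es by simp
    have out0: "outsum f v = 0" if "v \<in> V" for v
      using nb_eigen_outsum_zero[OF conn eps2 nd eig that] .
    have tw: "f (j, i) = - \<epsilon> * f (i, j)" if "(i, j) \<in> E" for i j
      by (rule nb_eigen_twisted[OF eig out0[OF arc_head[OF that]] that])
    have ext: "alt_ext \<epsilon> f e = f e" if "e \<in> E" for e
    proof -
      obtain i j where e: "e = (i, j)" by (cases e)
      show ?thesis using tw[of j i] arc_sym[of i j] that unfolding e by (auto simp: alt_ext_def)
    qed
    show "\<forall>v\<in>set vs. outsum (alt_ext \<epsilon> f) v = 0"
    proof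
      fix v assume "v \<in> set vs"
      then have "outsum f v = 0" using out0 vs by simp
      moreover have "outsum (alt_ext \<epsilon> f) v = outsum f v"
        unfolding outsum_def by (intro sum.cong refl ext) (simp add: nbrs_def)
      ultimately show "outsum (alt_ext \<epsilon> f) v = 0" by simp
    qed
    assume f0: "\<forall>e\<in>set us. f e = 0"
    have "f (i, j) = 0" if ij: "(i, j) \<in> E" for i j
    proof (cases "i < j")
      case True
      then show ?thesis using f0 us ij by (auto simp: oarcs_def)
    next
      case False
      then have "(j, i) \<in> oarcs" using arc_sym[OF ij] arc_irrefl[of i] ij by (cases "i = j") (auto simp: oarcs_def)
      then have "f (j, i) = 0" using f0 us by simp
      then show ?thesis using tw[OF arc_sym[OF ij]] by simp
    qed
    then show "\<forall>e\<in>set es. f e = 0" using es by auto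
  qed auto
qed

lemma kernel_dim_K_eq:
  assumes eps: "\<epsilon> = 1 \<or> \<epsilon> = -1"
  shows "kernel_dim (char_matrix K \<epsilon>) = kernel_dim (inc_mat \<epsilon>)\<^sup>T"
proof (rule antisym)
  have eps2: "\<epsilon> * \<epsilon> = 1" using eps by auto
  note iff = K_eigen_iff[OF eps, folded ks(2)] and tc = twisted_const_oarcs[OF eps2, folded us(2)]
  show "kernel_dim (char_matrix K \<epsilon>) \<le> kernel_dim (inc_mat \<epsilon>)\<^sup>T"
  proof (rule kernel_dim_mono(1)[OF ks(1) vs(1) acts_as_char_matrix[OF K] inc_mat_transpose, of "\<lambda>f v. f (Inl v)"])
    fix f assume "\<forall>x\<in>set ks. K_op f x - \<epsilon> * f x = 0"
    then have f: "twisted_const \<epsilon> (\<lambda>v. f (Inl v))" "\<forall>v\<in>V. f (Inr v) = - \<epsilon> * f (Inl v)"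
      unfolding iff by blast+
    show "\<forall>e\<in>set us. f (Inl (fst e)) - \<epsilon> * f (Inl (snd e)) = 0" using f(1) unfolding tc .
    show "\<forall>x\<in>set ks. f x = 0" if "\<forall>v\<in>set vs. f (Inl v) = 0"
      using that f(2) unfolding vs(2) ks(2) by auto
  qed auto
  show "kernel_dim (inc_mat \<epsilon>)\<^sup>T \<le> kernel_dim (char_matrix K \<epsilon>)"
  proof (rule kernel_dim_mono(1)[OF vs(1) ks(1) inc_mat_transpose acts_as_char_matrix[OF K],
          of "\<lambda>x. case_sum x (\<lambda>v. - \<epsilon> * x v)"])
    fix x assume "\<forall>e\<in>set us. x (fst e) - \<epsilon> * x (snd e) = 0"
    then show "\<forall>y\<in>set ks. K_op (case_sum x (\<lambda>v. - \<epsilon> * x v)) y - \<epsilon> * case_sum x (\<lambda>v. - \<epsilon> * x v) y = 0"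
      unfolding iff tc[symmetric] by simp
    show "\<forall>v\<in>set vs. x v = 0" if "\<forall>y\<in>set ks. case_sum x (\<lambda>v. - \<epsilon> * x v) y = 0"
    proof
      fix v assume "v \<in> set vs"
      then have "Inl v \<in> set ks" by simp
      from bspec[OF that this] show "x v = 0" by simp
    qed
  qed (auto simp: fun_eq_iff algebra_simps split: sum.splits)
qed

text \<open>
  Without a defect both matrices are semisimple at \<open>\<epsilon>\<close>: the eigenspace of \<open>B\<close> is the right
  kernel of the incidence matrix, that of \<open>K\<close> is the left kernel, and their dimensions differ by
  \<open>m - n\<close>.
\<close>

lemma dim_gen_eigenspace_no_defect:
  assumes eps: "\<epsilon> = 1 \<or> \<epsilon> = -1" and nd: "no_defect \<epsilon>"
  shows "dim_gen_eigenspace B \<epsilon> (Suc k) + card V = dim_gen_eigenspace K \<epsilon> (Suc k) + card oarcs"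
proof -
  have kerB: "mat_kernel (char_matrix B \<epsilon> ^\<^sub>m Suc k) = mat_kernel (char_matrix B \<epsilon>)"
  proof (rule mat_kernel_pow)
    let ?X = "char_matrix B \<epsilon>"
    show "?X \<in> carrier_mat (length es) (length es)" using acts_as_carrier[OF B] by simp
    fix v :: "complex vec" assume v: "v \<in> carrier_vec (length es)" and "?X *\<^sub>v (?X *\<^sub>v v) = 0\<^sub>v (length es)"
    define f where "f = fun_on es v"
    define h where "h e = nb_op f e - \<epsilon> * f e" for e
    have X: "?X *\<^sub>v vec_on es g = vec_on es (\<lambda>e. nb_op g e - \<epsilon> * g e)" for g
      using acts_as_char_matrix[OF B] by (simp add: acts_as_def)
    have Xv: "?X *\<^sub>v v = vec_on es h"
      using X[of f] vec_on_fun_on[OF es(1) v] unfolding f_def[symmetric] h_def by simp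
    then have "vec_on es (\<lambda>e. nb_op h e - \<epsilon> * h e) = 0\<^sub>v (length es)"
      using X[of h] \<open>?X *\<^sub>v (?X *\<^sub>v v) = _\<close> by simp
    then have "\<And>e. e \<in> E \<Longrightarrow> nb_op h e = \<epsilon> * h e" using es by (simp add: vec_on_eq_0_iff)
    from nb_no_generalised_eigenvector[OF conn eps nd h_def[symmetric] this]
    show "?X *\<^sub>v v = 0\<^sub>v (length es)" unfolding Xv vec_on_eq_0_iff using es by simp
  qed
  have kerK: "mat_kernel (char_matrix K \<epsilon> ^\<^sub>m Suc k) = mat_kernel (char_matrix K \<epsilon>)"
  proof (rule mat_kernel_pow)
    let ?X = "char_matrix K \<epsilon>"
    show "?X \<in> carrier_mat (length ks) (length ks)" using acts_as_carrier[OF K] by simp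
    fix v :: "complex vec" assume v: "v \<in> carrier_vec (length ks)" and "?X *\<^sub>v (?X *\<^sub>v v) = 0\<^sub>v (length ks)"
    define f where "f = fun_on ks v"
    define h where "h e = K_op f e - \<epsilon> * f e" for e
    have X: "?X *\<^sub>v vec_on ks g = vec_on ks (\<lambda>e. K_op g e - \<epsilon> * g e)" for g
      using acts_as_char_matrix[OF K] by (simp add: acts_as_def)
    have Xv: "?X *\<^sub>v v = vec_on ks h"
      using X[of f] vec_on_fun_on[OF ks(1) v] unfolding f_def[symmetric] h_def by simp
    then have "vec_on ks (\<lambda>e. K_op h e - \<epsilon> * h e) = 0\<^sub>v (length ks)"
      using X[of h] \<open>?X *\<^sub>v (?X *\<^sub>v v) = _\<close> by simp
    then have "\<And>x. x \<in> Inl ` V \<union> Inr ` V \<Longrightarrow> K_op h x - \<epsilon> * h x = 0"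
      unfolding vec_on_eq_0_iff ks(2) by blast
    from K_no_generalised_eigenvector[OF conn eps nd h_def[symmetric] this]
    show "?X *\<^sub>v v = 0\<^sub>v (length ks)" unfolding Xv vec_on_eq_0_iff ks(2) by blast
  qed
  have "dim_gen_eigenspace B \<epsilon> (Suc k) = kernel_dim (char_matrix B \<epsilon>)"
    unfolding dim_gen_eigenspace_def
    by (rule kernel_dim_cong[OF kerB]) (use acts_as_carrier[OF B] in \<open>simp add: char_matrix_def\<close>)
  moreover have "dim_gen_eigenspace K \<epsilon> (Suc k) = kernel_dim (char_matrix K \<epsilon>)"
    unfolding dim_gen_eigenspace_def
    by (rule kernel_dim_cong[OF kerK]) (use acts_as_carrier[OF K] in \<open>simp add: char_matrix_def\<close>)
  ultimately show ?thesis
    using kernel_dim_nb_eq[OF eps nd] kernel_dim_K_eq[OF eps] kernel_dim_inc_mat by simp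
qed

text \<open>
  If \<open>m = n\<close> and \<open>\<sigma>\<close> is a nonzero twisted constant function, the left and right kernels of the
  incidence matrix have the same dimension, but \<open>B\<close> has an eigenvector outside of the right
  kernel, namely some \<open>f\<close> whose outgoing sum is \<open>\<sigma>\<close>. On the edges it amounts to solving an
  inhomogeneous incidence system, which is possible since the right-hand side is orthogonal to
  the left kernel precisely when \<open>m = n\<close>.
\<close>

lemma dim_eigenspace_defect:
  assumes eps: "\<epsilon> = 1 \<or> \<epsilon> = -1" and d: "\<not> no_defect \<epsilon>"
  shows "dim_gen_eigenspace K \<epsilon> 1 < dim_gen_eigenspace B \<epsilon> 1"
proof -
  have eps2: "\<epsilon> * \<epsilon> = 1" using eps by auto
  obtain \<sigma> u where card: "card oarcs = card V" and tw: "twisted_const \<epsilon> \<sigma>" and u: "u \<in> V" "\<sigma> u \<noteq> 0"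
    using d unfolding no_defect_def by auto
  \<comment> \<open>Solve \<open>N g = (1 - lower) \<sigma>\<close>; setting the value on a descending arc to the alternating
    extension of \<open>g\<close> plus \<open>\<sigma>\<close> at its tail then gives the outgoing sums \<open>\<sigma>\<close>.\<close>
  define lower where "lower v = {w. (w, v) \<in> oarcs}" for v
  have fin_lower: "finite (lower v)" for v
    using finite_subset[of "lower v" V] finV arc_tail by (auto simp: lower_def oarcs_def)
  have "\<exists>g. \<forall>v\<in>set vs. (\<Sum>e\<in>set us. incidence \<epsilon> v e * g e) = (1 - of_nat (card (lower v))) * \<sigma> v"
  proof (rule fredholm_solvable[OF vs(1) us(1)])
    fix y assume "\<forall>e\<in>set us. (\<Sum>v\<in>set vs. incidence \<epsilon> v e * y v) = 0"
    then have "twisted_const \<epsilon> y"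
      unfolding twisted_const_oarcs[OF eps2] us(2) vs(2) by (simp add: incidence_transpose oarcs_def)
    then obtain c where c: "\<And>v. v \<in> V \<Longrightarrow> \<sigma> v * y v = c"
      using twisted_const_prod_const[OF conn eps2 tw] by blast
    have "(\<Sum>v\<in>V. card (lower v)) = card oarcs"
    proof -
      have "prod.swap ` Sigma V lower = oarcs"
        using arc_head by (force simp: lower_def oarcs_def image_iff)
      then have "card oarcs = card (Sigma V lower)" by (metis card_image inj_swap)
      then show ?thesis using finV fin_lower by simp
    qed
    then have "(\<Sum>v\<in>V. of_nat (card (lower v)) :: complex) = of_nat (card oarcs)"
      by (metis of_nat_sum)
    moreover have "(\<Sum>v\<in>set vs. (1 - of_nat (card (lower v))) * \<sigma> v * y v) = (\<Sum>v\<in>V. (1 - of_nat (card (lower v))) * c)"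
      unfolding vs(2) by (intro sum.cong refl) (simp add: c mult.assoc)
    ultimately show "(\<Sum>v\<in>set vs. (1 - of_nat (card (lower v))) * \<sigma> v * y v) = 0"
      using card by (simp add: sum_subtractf flip: sum_distrib_right)
  qed
  then obtain g where g: "\<And>v. v \<in> V \<Longrightarrow> outsum (alt_ext \<epsilon> g) v = (1 - of_nat (card (lower v))) * \<sigma> v"
    unfolding us(2) vs(2) outsum_alt_ext by blast
  define f where "f e = alt_ext \<epsilon> g e + (if snd e < fst e then \<sigma> (fst e) else 0)" for e
  have out: "outsum f v = \<sigma> v" if "v \<in> V" for v
  proof -
    have "nbrs v \<inter> {w. w < v} = lower v" using arc_sym by (auto simp: nbrs_def lower_def oarcs_def)
    then have "(\<Sum>w\<in>nbrs v. if w < v then \<sigma> v else 0) = of_nat (card (lower v)) * \<sigma> v"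
      by (simp add: sum.If_cases)
    then have "outsum f v = outsum (alt_ext \<epsilon> g) v + of_nat (card (lower v)) * \<sigma> v"
      unfolding outsum_def by (simp add: f_def sum.distrib del: fst_conv) (simp only: fst_conv)
    then show ?thesis using g[OF that] by (simp add: algebra_simps)
  qed
  have f: "\<forall>e\<in>set es. nb_op f e - \<epsilon> * f e = 0"
  proof
    fix e assume "e \<in> set es"
    then obtain i j where e: "e = (i, j)" "(i, j) \<in> E" using es by (metis surj_pair)
    have "f (j, i) + \<epsilon> * f (i, j) = \<sigma> j"
    proof -
      have swap: "alt_ext \<epsilon> g (j, i) + \<epsilon> * alt_ext \<epsilon> g (i, j) = 0"
        using alt_ext_swap[OF eps2 e(2)] by simp
      have "\<epsilon> * \<sigma> i = \<sigma> j" using twisted_constD[OF tw arc_sym[OF e(2)]] by simp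
      moreover have "i < j \<or> j < i" using e(2) arc_irrefl by (cases i j rule: linorder_cases) auto
      ultimately show ?thesis using swap by (auto simp: f_def algebra_simps)
    qed
    then show "nb_op f e - \<epsilon> * f e = 0" using out[OF arc_head[OF e(2)]] e by (simp add: nb_op_def algebra_simps)
  qed
  have "kernel_dim (inc_mat \<epsilon>) \<noteq> kernel_dim (char_matrix B \<epsilon>)"
  proof
    assume eq: "kernel_dim (inc_mat \<epsilon>) = kernel_dim (char_matrix B \<epsilon>)"
    have "\<exists>g. (\<forall>v\<in>set vs. outsum (alt_ext \<epsilon> g) v = 0) \<and> (\<forall>e\<in>set es. f e = alt_ext \<epsilon> g e)"
      by (rule kernel_dim_mono(2)[OF us(1) es(1) inc_mat[of \<epsilon>] acts_as_char_matrix[OF B, of \<epsilon>], of "alt_ext \<epsilon>"])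
        (use nb_alt_ext[OF eps2] alt_ext_inj f eq in \<open>simp_all add: alt_ext_add alt_ext_smult\<close>)
    then obtain g' where g': "\<forall>v\<in>V. outsum (alt_ext \<epsilon> g') v = 0" "\<forall>e\<in>E. f e = alt_ext \<epsilon> g' e"
      using vs es by auto
    have "outsum f u = outsum (alt_ext \<epsilon> g') u"
      unfolding outsum_def by (intro sum.cong refl) (use g'(2) in \<open>simp add: nbrs_def\<close>)
    then show False using g'(1) u out by simp
  qed
  then have "kernel_dim (inc_mat \<epsilon>) < kernel_dim (char_matrix B \<epsilon>)"
    using kernel_dim_inc_le[OF eps2] by (simp add: order.strict_iff_order)
  moreover have "kernel_dim (inc_mat \<epsilon>) = kernel_dim (inc_mat \<epsilon>)\<^sup>T" using kernel_dim_inc_mat[of \<epsilon>] card by simp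
  ultimately show ?thesis
    using kernel_dim_K_eq[OF eps] acts_as_carrier[OF B] acts_as_carrier[OF K]
    by (simp add: dim_gen_eigenspace_def)
qed

end

section \<open>Cycles and flows\<close>

text \<open>
  A cycle of length \<open>L\<close> as its sequence of vertices, which returns to its start at position \<open>L\<close>.
\<close>

definition closed_cycle :: "('v \<times> 'v) set \<Rightarrow> (nat \<Rightarrow> 'v) \<Rightarrow> nat \<Rightarrow> bool" where
  "closed_cycle E v L \<longleftrightarrow> 3 \<le> L \<and> inj_on v {..<L} \<and> v L = v 0 \<and> (\<forall>k<L. (v k, v (Suc k)) \<in> E)"

definition cycle_edges :: "(nat \<Rightarrow> 'v) \<Rightarrow> nat \<Rightarrow> 'v set set" where
  "cycle_edges v L = (\<lambda>k. {v k, v (Suc k)}) ` {..<L}"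

text \<open>
  This is where the length of a cycle has to be at least \<open>3\<close>.
\<close>

lemma closed_cycle_no_reversed_arc:
  assumes c: "closed_cycle E v L" and k: "k < L" and m: "m < L"
    and 1: "v (Suc m) = v k" and 2: "v m = v (Suc k)"
  shows False
proof -
  have L: "3 \<le> L" and inj: "\<And>i j. i < L \<Longrightarrow> j < L \<Longrightarrow> v i = v j \<Longrightarrow> i = j" and vL: "v L = v 0"
    using c by (auto simp: closed_cycle_def inj_on_def)
  \<comment> \<open>The only vertex index below \<open>L\<close> that represents the successor of \<open>i\<close> is \<open>i + 1\<close> modulo \<open>L\<close>.\<close>
  have suc: "(Suc i < L \<and> j = Suc i) \<or> (Suc i = L \<and> j = 0)" if "i < L" "j < L" "v (Suc i) = v j" for i j
  proof (cases "Suc i < L")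
    case False
    then have "Suc i = L" using that by simp
    then show ?thesis using inj[of 0 j] that vL L by auto
  qed (use inj[of "Suc i" j] that in auto)
  show False using suc[OF m k 1] suc[OF k m 2[symmetric]] L by auto
qed

lemma card_cycle_edges:
  assumes "closed_cycle E v L"
  shows "card (cycle_edges v L) = L"
proof -
  have "inj_on (\<lambda>k. {v k, v (Suc k)}) {..<L}"
  proof (rule inj_onI)
    fix k m assume "k \<in> {..<L}" "m \<in> {..<L}" "{v k, v (Suc k)} = {v m, v (Suc m)}"
    then show "k = m"
      using closed_cycle_no_reversed_arc[OF assms, of k m] assms
      by (auto simp: doubleton_eq_iff closed_cycle_def inj_on_def)
  qed
  then show ?thesis unfolding cycle_edges_def by (simp add: card_image)
qed

text \<open>
  Cut out a shortest stretch of the walk between two visits of the same vertex. Its length is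
  not \<open>1\<close>, as there are no loops, and not \<open>2\<close>, as the walk does not backtrack.
\<close>

lemma finite_nonbacktracking_walk_closed_cycle:
  fixes v :: "nat \<Rightarrow> 'v"
  assumes fin: "finite V" and V: "\<And>k. v k \<in> V" and S: "\<And>k. (v k, v (Suc k)) \<in> S"
    and irrefl: "\<And>i. (i, i) \<notin> S" and nb: "\<And>k. v (Suc (Suc k)) \<noteq> v k"
  shows "\<exists>w L. closed_cycle S w L"
proof -
  define P where "P d \<longleftrightarrow> 0 < d \<and> (\<exists>i. v (i + d) = v i)" for d
  have "\<not> inj v"
    using fin V by (meson finite_imageD finite_subset image_subsetI infinite_UNIV_nat)
  then obtain i j where ij: "v i = v j" "i < j" unfolding inj_def by (metis linorder_neqE_nat)
  then have "P (j - i)" unfolding P_def by (intro conjI exI[of _ i]) auto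
  then have PL: "P (Least P)" by (rule LeastI)
  have min: "\<not> P d" if "d < Least P" for d using that by (rule not_less_Least)
  define L where "L = Least P"
  obtain a where a: "v (a + L) = v a" "0 < L" using PL unfolding P_def L_def by blast
  have "L \<noteq> 1" using a S[of a] irrefl by auto
  moreover have "L \<noteq> 2" using a nb[of a] by auto
  ultimately have L3: "3 \<le> L" using a by linarith
  have less: "v (a + x) \<noteq> v (a + y)" if "x < y" "y < L" for x y
  proof
    assume "v (a + x) = v (a + y)"
    then have "P (y - x)" unfolding P_def using that by (intro conjI exI[of _ "a + x"]) auto
    then show False using min[of "y - x"] that unfolding L_def by auto
  qed
  then have "inj_on (\<lambda>k. v (a + k)) {..<L}"
    by (intro inj_onI) (metis lessThan_iff linorder_neqE_nat)
  then have "closed_cycle S (\<lambda>k. v (a + k)) L"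
    using L3 a S by (auto simp: closed_cycle_def)
  then show ?thesis by blast
qed

context arc_graph begin

text \<open>
  The right kernel of the incidence matrix, seen on the arcs: circulations for \<open>\<epsilon> = 1\<close>.
\<close>

definition flow :: "complex \<Rightarrow> ('v \<times> 'v \<Rightarrow> complex) \<Rightarrow> bool" where
  "flow \<epsilon> f \<longleftrightarrow> (\<forall>(i, j)\<in>E. f (j, i) = - \<epsilon> * f (i, j)) \<and> (\<forall>v\<in>V. outsum f v = 0)"

lemma flowD: "flow \<epsilon> f \<Longrightarrow> (i, j) \<in> E \<Longrightarrow> f (j, i) = - \<epsilon> * f (i, j)"
  by (auto simp: flow_def)

text \<open>
  Put \<open>\<epsilon>^k\<close> on the \<open>k\<close>-th arc of the cycle and \<open>- \<epsilon>^(k+1)\<close> on its reversal. At each vertex the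
  contributions telescope around the cycle and cancel because \<open>\<epsilon>^L = 1\<close>.
\<close>

lemma cycle_flow:
  assumes c: "closed_cycle E v L" and eps: "\<epsilon> = 1 \<or> \<epsilon> = -1" and L: "\<epsilon> ^ L = 1"
  obtains f where "flow \<epsilon> f"
    and "\<And>i j. (i, j) \<in> E \<Longrightarrow> f (i, j) \<noteq> 0 \<longleftrightarrow> {i, j} \<in> cycle_edges v L"
proof -
  define \<delta> :: "bool \<Rightarrow> complex" where "\<delta> b = (if b then 1 else 0)" for b
  let ?a = "\<lambda>k. (v k, v (Suc k))"
  define f where "f e = (\<Sum>k<L. \<epsilon> ^ k * \<delta> (e = ?a k) - \<epsilon> ^ Suc k * \<delta> (prod.swap e = ?a k))" for e
  have arc: "?a k \<in> E" if "k < L" for k using c that by (auto simp: closed_cycle_def)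
  have swap: "f (j, i) = - \<epsilon> * f (i, j)" for i j
    unfolding f_def sum_distrib_left using eps by (intro sum.cong refl) auto
  have out: "outsum f u = 0" for u
  proof -
    have tail: "(\<Sum>w\<in>nbrs u. \<delta> ((u, w) = ?a k)) = \<delta> (u = v k)" if k: "k < L" for k
    proof (cases "u = v k")
      case True
      then have "(\<Sum>w\<in>nbrs u. \<delta> ((u, w) = ?a k)) = (\<Sum>w\<in>nbrs u. if w = v (Suc k) then 1 else 0)"
        by (intro sum.cong refl) (simp add: \<delta>_def)
      moreover have "v (Suc k) \<in> nbrs u" using arc[OF k] True by (simp add: nbrs_def)
      ultimately show ?thesis using True by (simp add: \<delta>_def)
    qed (simp add: \<delta>_def)
    have head: "(\<Sum>w\<in>nbrs u. \<delta> ((w, u) = ?a k)) = \<delta> (u = v (Suc k))" if k: "k < L" for k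
    proof (cases "u = v (Suc k)")
      case True
      then have "(\<Sum>w\<in>nbrs u. \<delta> ((w, u) = ?a k)) = (\<Sum>w\<in>nbrs u. if w = v k then 1 else 0)"
        by (intro sum.cong refl) (simp add: \<delta>_def)
      moreover have "v k \<in> nbrs u" using arc_sym[OF arc[OF k]] True by (simp add: nbrs_def)
      ultimately show ?thesis using True by (simp add: \<delta>_def)
    qed (simp add: \<delta>_def)
    have "outsum f u = (\<Sum>k<L. \<Sum>w\<in>nbrs u. \<epsilon> ^ k * \<delta> ((u, w) = ?a k) - \<epsilon> ^ Suc k * \<delta> ((w, u) = ?a k))"
      unfolding outsum_def f_def by (subst sum.swap) (simp del: prod.inject)
    also have "\<dots> = (\<Sum>k<L. \<epsilon> ^ k * \<delta> (u = v k) - \<epsilon> ^ Suc k * \<delta> (u = v (Suc k)))"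
      unfolding sum_subtractf sum_distrib_left[symmetric] using tail head
      by (intro arg_cong2[of _ _ _ _ "(-)"] sum.cong refl) (simp_all del: prod.inject)
    also have "\<dots> = \<epsilon> ^ 0 * \<delta> (u = v 0) - \<epsilon> ^ L * \<delta> (u = v L)"
      by (rule sum_lessThan_telescope')
    also have "\<dots> = 0" using c L by (simp add: closed_cycle_def)
    finally show ?thesis .
  qed
  have on: "f (?a m) = \<epsilon> ^ m" if m: "m < L" for m
  proof -
    have "f (?a m) = (\<Sum>k<L. if k = m then \<epsilon> ^ m else 0)"
      unfolding f_def
    proof (intro sum.cong refl)
      fix k assume "k \<in> {..<L}"
      then have k: "k < L" by simp
      have iff: "?a m = ?a k \<longleftrightarrow> k = m" using c k m by (auto simp: closed_cycle_def inj_on_def)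
      have neq: "(prod.swap (?a m) = ?a k) = False"
        using closed_cycle_no_reversed_arc[OF c k m] by auto
      show "\<epsilon> ^ k * \<delta> (?a m = ?a k) - \<epsilon> ^ Suc k * \<delta> (prod.swap (?a m) = ?a k) = (if k = m then \<epsilon> ^ m else 0)"
        unfolding \<delta>_def iff neq by simp
    qed
    then show ?thesis using m by simp
  qed
  have supp: "f (i, j) \<noteq> 0 \<longleftrightarrow> {i, j} \<in> cycle_edges v L" for i j
  proof
    assume "f (i, j) \<noteq> 0"
    then obtain k where "k < L" "\<epsilon> ^ k * \<delta> ((i, j) = ?a k) - \<epsilon> ^ Suc k * \<delta> (prod.swap (i, j) = ?a k) \<noteq> 0"
      unfolding f_def by (metis (no_types, lifting) lessThan_iff sum.neutral)
    then have "k < L" "{i, j} = {v k, v (Suc k)}" by (auto simp: \<delta>_def split: if_splits)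
    then show "{i, j} \<in> cycle_edges v L" unfolding cycle_edges_def by blast
  next
    assume "{i, j} \<in> cycle_edges v L"
    then obtain k where k: "k < L" "{i, j} = {v k, v (Suc k)}" unfolding cycle_edges_def by auto
    then have "(i, j) = ?a k \<or> (j, i) = ?a k" by (auto simp: doubleton_eq_iff)
    moreover have "f (?a k) \<noteq> 0" using on[OF k(1)] eps by auto
    ultimately show "f (i, j) \<noteq> 0" using swap[of j i] eps by auto
  qed
  have "flow \<epsilon> f" unfolding flow_def by (intro conjI ballI out) (clarify, rule swap)
  then show ?thesis using supp by (rule that)
qed

text \<open>
  A vertex that is entered along an arc of the support can be left along another edge of the
  support, since otherwise the outgoing sum would have a single nonzero term. So the support
  carries an infinite non-backtracking walk.
\<close>

lemma flow_support_contains_cycle: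
  assumes eps: "\<epsilon> = 1 \<or> \<epsilon> = -1" and f: "flow \<epsilon> f" and e: "e \<in> E" "f e \<noteq> 0"
  obtains v L where "closed_cycle E v L" "\<And>k. k < L \<Longrightarrow> f (v k, v (Suc k)) \<noteq> 0"
proof -
  define S where "S = {e \<in> E. f e \<noteq> 0}"
  have step: "\<exists>b. b \<in> S \<and> fst b = snd a \<and> snd b \<noteq> fst a" if a: "a \<in> S" for a
  proof (rule ccontr)
    assume none: "\<not> ?thesis"
    obtain i j where ij: "a = (i, j)" by (cases a)
    then have E: "(i, j) \<in> E" "f (i, j) \<noteq> 0" using a by (auto simp: S_def)
    have "outsum f j = (\<Sum>l\<in>nbrs j. if l = i then f (j, i) else 0)"
      unfolding outsum_def by (intro sum.cong refl) (use none ij in \<open>auto simp: S_def nbrs_def\<close>)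
    also have "i \<in> nbrs j" using arc_sym[OF E(1)] by (simp add: nbrs_def)
    then have "(\<Sum>l\<in>nbrs j. if l = i then f (j, i) else 0) = f (j, i)" by simp
    also have "\<dots> = - \<epsilon> * f (i, j)" using f E by (auto simp: flow_def)
    finally show False using f E arc_head[OF E(1)] eps by (auto simp: flow_def)
  qed
  have "\<exists>a. \<forall>n. a n \<in> S \<and> (fst (a (Suc n)) = snd (a n) \<and> snd (a (Suc n)) \<noteq> fst (a n))"
  proof (rule dependent_nat_choice)
    show "\<exists>a. a \<in> S" using e unfolding S_def by blast
    show "\<exists>b. b \<in> S \<and> (fst b = snd a \<and> snd b \<noteq> fst a)" if "a \<in> S" for a and n :: nat
      using step[OF that] .
  qed
  then obtain a where a: "\<And>n. a n \<in> S" "\<And>n. fst (a (Suc n)) = snd (a n)" "\<And>n. snd (a (Suc n)) \<noteq> fst (a n)"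
    by blast
  define v where "v k = fst (a k)" for k
  have vS: "(v k, v (Suc k)) \<in> S" for k using a(1)[of k] a(2)[of k] by (simp add: v_def)
  have "\<exists>w L. closed_cycle S w L"
  proof (rule finite_nonbacktracking_walk_closed_cycle[of V v S])
    show "v k \<in> V" for k using vS[of k] arc_tail by (auto simp: S_def)
    show "v (Suc (Suc k)) \<noteq> v k" for k using a(2)[of "Suc k"] a(3)[of k] by (simp add: v_def)
  qed (use vS finV arc_irrefl in \<open>auto simp: S_def\<close>)
  then obtain w L where "closed_cycle S w L" by blast
  then show ?thesis by (intro that[of w L]) (auto simp: closed_cycle_def S_def)
qed

lemma flow_alt_ext:
  assumes "\<epsilon> = 1 \<or> \<epsilon> = -1" "\<forall>v\<in>V. outsum (alt_ext \<epsilon> g) v = 0"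
  shows "flow \<epsilon> (alt_ext \<epsilon> g)"
  using assms arc_irrefl by (auto simp: flow_def alt_ext_def)

lemma flow_eq_alt_ext:
  assumes "flow \<epsilon> f" "e \<in> E"
  shows "alt_ext \<epsilon> f e = f e"
proof -
  obtain i j where e: "e = (i, j)" by (cases e)
  then have "f (i, j) = - \<epsilon> * f (j, i)" using flowD[OF assms(1) arc_sym] assms(2) by simp
  then show ?thesis unfolding e by (simp add: alt_ext_def)
qed

lemma flow_outsum_alt_ext:
  assumes "flow \<epsilon> f" "v \<in> V"
  shows "outsum (alt_ext \<epsilon> f) v = 0"
proof -
  have "outsum (alt_ext \<epsilon> f) v = outsum f v"
    unfolding outsum_def by (intro sum.cong refl flow_eq_alt_ext[OF assms(1)]) (simp add: nbrs_def)
  then show ?thesis using assms by (simp add: flow_def)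
qed

end

lemma kernel_dim_le_cols: "kernel_dim A \<le> dim_col A"
  by (simp add: kernel_dim_code)

text \<open>
  The kernel of this matrix without rows is the whole line. It serves as the reference space for
  statements that some kernel has dimension at least or at most one.
\<close>

lemma kernel_dim_0_1: "kernel_dim (0\<^sub>m 0 (Suc 0) :: 'a :: field mat) = 1"
  using kernel_dim_transpose[of "0\<^sub>m 0 1 :: 'a mat" 0 1] kernel_dim_le_cols[of "0\<^sub>m 0 1 :: 'a mat"] by simp

lemma acts_as_0_1: "acts_as [] [()] (0\<^sub>m 0 1 :: 'a :: field mat) \<Phi>"
  by (auto simp: acts_as_def vec_on_def)

lemma acts_as_0_0: "acts_as [] [] (0\<^sub>m 0 0 :: 'a :: field mat) \<Phi>"
  by (auto simp: acts_as_def vec_on_def)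

context enumerated_arc_graph begin

lemma kernel_dim_transpose_pos:
  assumes eps: "\<epsilon> * \<epsilon> = 1"
  shows "0 < kernel_dim (inc_mat \<epsilon>)\<^sup>T \<longleftrightarrow> (\<exists>x v. twisted_const \<epsilon> x \<and> v \<in> V \<and> x v \<noteq> 0)"
proof
  assume pos: "0 < kernel_dim (inc_mat \<epsilon>)\<^sup>T"
  show "\<exists>x v. twisted_const \<epsilon> x \<and> v \<in> V \<and> x v \<noteq> 0"
  proof (rule ccontr)
    assume none: "\<not> ?thesis"
    have "kernel_dim (inc_mat \<epsilon>)\<^sup>T \<le> kernel_dim (0\<^sub>m 0 0 :: complex mat)"
    proof (rule kernel_dim_mono(1)[OF vs(1) distinct.simps(1)[THEN iffD2, OF TrueI] inc_mat_transpose acts_as_0_0,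
          of "\<lambda>x _. 0"])
      fix x assume "\<forall>e\<in>set us. x (fst e) - \<epsilon> * x (snd e) = 0"
      then have "twisted_const \<epsilon> x" unfolding twisted_const_oarcs[OF eps] us(2) .
      then show "\<forall>v\<in>set vs. x v = 0" using none vs(2) by blast
    qed auto
    then show False using pos kernel_dim_le_cols[of "0\<^sub>m 0 0 :: complex mat"] by simp
  qed
next
  assume "\<exists>x v. twisted_const \<epsilon> x \<and> v \<in> V \<and> x v \<noteq> 0"
  then obtain x v where x: "twisted_const \<epsilon> x" "v \<in> V" "x v \<noteq> 0" by blast
  have "kernel_dim (0\<^sub>m 0 1 :: complex mat) \<le> kernel_dim (inc_mat \<epsilon>)\<^sup>T"
  proof (rule kernel_dim_mono(1)[OF _ vs(1) acts_as_0_1 inc_mat_transpose, of "\<lambda>c u. c () * x u"])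
    fix c :: "unit \<Rightarrow> complex"
    show "\<forall>e\<in>set us. c () * x (fst e) - \<epsilon> * (c () * x (snd e)) = 0"
      using x(1) unfolding twisted_const_oarcs[OF eps] us(2) by (auto simp: algebra_simps)
    show "\<forall>y\<in>set [()]. c y = 0" if "\<forall>u\<in>set vs. c () * x u = 0"
      using that x(2,3) vs(2) by auto
  qed (auto simp: algebra_simps)
  then show "0 < kernel_dim (inc_mat \<epsilon>)\<^sup>T" by (simp add: kernel_dim_0_1)
qed

lemma kernel_dim_transpose_const:
  assumes "V \<noteq> {}"
  shows "kernel_dim (inc_mat 1)\<^sup>T = 1"
proof (rule antisym)
  obtain u where u: "u \<in> V" using assms by auto
  have "kernel_dim (inc_mat 1)\<^sup>T \<le> kernel_dim (0\<^sub>m 0 1 :: complex mat)"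
  proof (rule kernel_dim_mono(1)[OF vs(1) _ inc_mat_transpose acts_as_0_1, of "\<lambda>x _. x u"])
    fix x :: "'v \<Rightarrow> complex" assume "\<forall>e\<in>set us. x (fst e) - 1 * x (snd e) = 0"
    then have "twisted_const 1 x" using twisted_const_oarcs[of 1 x] us(2) by simp
    then have eq: "x v = x u" if "v \<in> V" for v
      using conn that u unfolding adj_connected_def twisted_const_def by simp
    show "\<forall>v\<in>set vs. x v = 0" if "\<forall>y\<in>set [()]. x u = 0" using that eq vs(2) by simp
  qed auto
  then show "kernel_dim (inc_mat 1)\<^sup>T \<le> 1" by (simp add: kernel_dim_0_1)
  have "twisted_const 1 (\<lambda>_. 1)" by (auto simp: twisted_const_def)
  then have "0 < kernel_dim (inc_mat 1)\<^sup>T"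
    using u by (subst kernel_dim_transpose_pos) (auto intro!: exI[of _ "\<lambda>_. 1"])
  then show "1 \<le> kernel_dim (inc_mat 1)\<^sup>T" by simp
qed

lemma flow_nonzero_oarc:
  assumes "\<epsilon> = 1 \<or> \<epsilon> = -1" "flow \<epsilon> f" "e \<in> E" "f e \<noteq> 0"
  shows "\<exists>e\<in>oarcs. f e \<noteq> 0"
proof -
  have "e \<in> oarcs \<or> prod.swap e \<in> oarcs" using assms(3) arcs_as_oarcs(1) by auto
  moreover have "f (prod.swap e) \<noteq> 0" using assms by (cases e) (auto simp: flow_def)
  ultimately show ?thesis using assms(4) by blast
qed

text \<open>
  The line spanned by a nonzero flow maps injectively into the right kernel; if that has
  dimension one, the map is onto, so that all flows are multiples of the given one.
\<close>

lemma kernel_dim_flow_pos: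
  assumes eps: "\<epsilon> = 1 \<or> \<epsilon> = -1" and f: "flow \<epsilon> f" "e \<in> E" "f e \<noteq> 0"
  shows "0 < kernel_dim (inc_mat \<epsilon>)"
    and "kernel_dim (inc_mat \<epsilon>) \<le> 1 \<Longrightarrow> flow \<epsilon> g \<Longrightarrow> \<exists>c. \<forall>e\<in>E. g e = c * f e"
proof -
  obtain a where a: "a \<in> oarcs" "f a \<noteq> 0" using flow_nonzero_oarc[OF eps f] by blast
  have d: "distinct [()]" by simp
  have maps: "\<forall>x\<in>set vs. outsum (alt_ext \<epsilon> (\<lambda>e. c () * f e)) x = 0" for c :: "unit \<Rightarrow> complex"
    using flow_outsum_alt_ext[OF f(1)] vs(2)
    by (simp add: alt_ext_smult outsum_def flip: sum_distrib_left)
  have inj: "\<forall>y\<in>set [()]. c y = 0" if "\<forall>y\<in>set us. c () * f y = 0" for c :: "unit \<Rightarrow> complex"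
    using that a us(2) by auto
  note mono = kernel_dim_mono[OF d us(1) acts_as_0_1 inc_mat, of "\<lambda>c y. c () * f y"]
  have "kernel_dim (0\<^sub>m 0 1 :: complex mat) \<le> kernel_dim (inc_mat \<epsilon>)"
  proof (rule mono(1))
    fix c :: "unit \<Rightarrow> complex"
    show "\<forall>x\<in>set vs. outsum (alt_ext \<epsilon> (\<lambda>y. c () * f y)) x = 0" by (rule maps)
    show "\<forall>y\<in>set us. c () * f y = 0 \<Longrightarrow> \<forall>y\<in>set [()]. c y = 0" by (rule inj)
  qed (auto simp: algebra_simps)
  then show pos: "0 < kernel_dim (inc_mat \<epsilon>)" by (simp add: kernel_dim_0_1)
  assume "kernel_dim (inc_mat \<epsilon>) \<le> 1" and g: "flow \<epsilon> g"
  then have eq: "kernel_dim (0\<^sub>m 0 1 :: complex mat) = kernel_dim (inc_mat \<epsilon>)"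
    using pos by (simp add: kernel_dim_0_1)
  have "\<exists>c :: unit \<Rightarrow> complex. (\<forall>x\<in>set []. undefined c x = (0 :: complex)) \<and> (\<forall>y\<in>set us. g y = c () * f y)"
  proof (rule mono(2)[OF _ _ _ _ eq])
    fix c :: "unit \<Rightarrow> complex"
    show "\<forall>x\<in>set vs. outsum (alt_ext \<epsilon> (\<lambda>y. c () * f y)) x = 0" by (rule maps)
    show "\<forall>y\<in>set us. c () * f y = 0 \<Longrightarrow> \<forall>y\<in>set [()]. c y = 0" by (rule inj)
    show "\<forall>x\<in>set vs. outsum (alt_ext \<epsilon> g) x = 0" using flow_outsum_alt_ext[OF g] vs(2) by simp
  qed (auto simp: algebra_simps)
  then obtain c where c: "\<And>e. e \<in> oarcs \<Longrightarrow> g e = c * f e" using us(2) by auto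
  have "g e = c * f e" if e: "e \<in> E" for e
  proof -
    have "alt_ext \<epsilon> g e = c * alt_ext \<epsilon> f e"
      using e c arc_sym[of "fst e" "snd e"] arc_irrefl[of "fst e"]
      by (cases e) (auto simp: alt_ext_def oarcs_def not_less order_le_less)
    then show ?thesis using flow_eq_alt_ext[OF g e] flow_eq_alt_ext[OF f(1) e] by simp
  qed
  then show "\<exists>c. \<forall>e\<in>E. g e = c * f e" by blast
qed

text \<open>
  Evaluation at the arc \<open>a\<close> is a linear form and cannot be injective on a space of dimension at
  least two.
\<close>

lemma flow_avoiding_arc:
  assumes dim: "1 < kernel_dim (inc_mat \<epsilon>)" and eps: "\<epsilon> = 1 \<or> \<epsilon> = -1" and a: "a \<in> E"
  shows "\<exists>f e. flow \<epsilon> f \<and> e \<in> E \<and> f e \<noteq> 0 \<and> f a = 0"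
proof (rule ccontr)
  assume none: "\<not> ?thesis"
  have d: "distinct [()]" by simp
  have "kernel_dim (inc_mat \<epsilon>) \<le> kernel_dim (0\<^sub>m 0 1 :: complex mat)"
  proof (rule kernel_dim_mono(1)[OF us(1) d inc_mat acts_as_0_1, of "\<lambda>g _. alt_ext \<epsilon> g a"])
    fix g assume "\<forall>v\<in>set vs. outsum (alt_ext \<epsilon> g) v = 0"
    then have fl: "flow \<epsilon> (alt_ext \<epsilon> g)" using flow_alt_ext[OF eps] vs(2) by simp
    assume "\<forall>y\<in>set [()]. alt_ext \<epsilon> g a = 0"
    then have "\<forall>e\<in>set es. alt_ext \<epsilon> g e = 0" using none fl es(2) by auto
    then show "\<forall>e\<in>set us. g e = 0" by (rule alt_ext_inj)
  qed (auto simp: alt_ext_add alt_ext_smult)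
  then show False using dim by (simp add: kernel_dim_0_1)
qed

text \<open>
  The circulation of the cycle makes the right kernel for \<open>\<epsilon> = 1\<close> nonzero, while the left kernel
  is the line of constants; the dimensions of these kernels differ by \<open>m - n\<close>.
\<close>

lemma cycle_imp_edges_ge_vertices:
  assumes c: "closed_cycle E v L"
  shows "card V \<le> card oarcs"
proof -
  have "(v 0, v 1) \<in> E" using c by (auto simp: closed_cycle_def)
  have V: "V \<noteq> {}" using \<open>(v 0, v 1) \<in> E\<close> arc_tail by auto
  have "{v 0, v 1} \<in> cycle_edges v L" using c by (force simp: cycle_edges_def closed_cycle_def)
  obtain f where f: "flow 1 f" "\<And>i j. (i, j) \<in> E \<Longrightarrow> f (i, j) \<noteq> 0 \<longleftrightarrow> {i, j} \<in> cycle_edges v L"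
    using cycle_flow[OF c, of 1] by auto
  have "f (v 0, v 1) \<noteq> 0" using f(2) \<open>(v 0, v 1) \<in> E\<close> \<open>{v 0, v 1} \<in> _\<close> by simp
  then have "0 < kernel_dim (inc_mat 1)"
    using kernel_dim_flow_pos(1)[of 1 f "(v 0, v 1)"] f(1) \<open>(v 0, v 1) \<in> E\<close> by simp
  then show ?thesis using kernel_dim_inc_mat[of 1] kernel_dim_transpose_const[OF V] by linarith
qed

text \<open>
  Now the circulations form a line, so the circulations of two cycles are proportional and have
  the same support.
\<close>

lemma edges_eq_vertices_imp_unique_cycle:
  assumes m: "card oarcs = card V" and c: "closed_cycle E v L" and c': "closed_cycle E v' L'"
  shows "cycle_edges v L = cycle_edges v' L'"
proof -
  have v01: "(v 0, v 1) \<in> E" using c by (auto simp: closed_cycle_def)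
  have V: "V \<noteq> {}" using v01 arc_tail by auto
  have dim: "kernel_dim (inc_mat 1) \<le> 1"
    using kernel_dim_inc_mat[of 1] kernel_dim_transpose_const[OF V] m by simp
  have sub: "cycle_edges w' M' \<subseteq> cycle_edges w M"
    if c: "closed_cycle E w M" and c': "closed_cycle E w' M'" for w w' M M'
  proof -
    obtain f where f: "flow 1 f" "\<And>i j. (i, j) \<in> E \<Longrightarrow> f (i, j) \<noteq> 0 \<longleftrightarrow> {i, j} \<in> cycle_edges w M"
      using cycle_flow[OF c, of 1] by auto
    obtain g where g: "flow 1 g" "\<And>i j. (i, j) \<in> E \<Longrightarrow> g (i, j) \<noteq> 0 \<longleftrightarrow> {i, j} \<in> cycle_edges w' M'"
      using cycle_flow[OF c', of 1] by auto
    have w01: "(w 0, w 1) \<in> E" using c by (auto simp: closed_cycle_def)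
    have "{w 0, w 1} \<in> cycle_edges w M" using c by (force simp: cycle_edges_def closed_cycle_def)
    then have "f (w 0, w 1) \<noteq> 0" using f(2)[OF w01] by simp
    then obtain b where b: "\<forall>e\<in>E. g e = b * f e"
      using kernel_dim_flow_pos(2)[of 1 f "(w 0, w 1)" g] f(1) g(1) w01 dim by auto
    show ?thesis
    proof
      fix C assume C: "C \<in> cycle_edges w' M'"
      then obtain k where k: "k < M'" "C = {w' k, w' (Suc k)}" unfolding cycle_edges_def by auto
      have kE: "(w' k, w' (Suc k)) \<in> E" using c' k by (auto simp: closed_cycle_def)
      then have "g (w' k, w' (Suc k)) \<noteq> 0" using g(2) C k by simp
      then have "f (w' k, w' (Suc k)) \<noteq> 0" using b kE by auto
      then show "C \<in> cycle_edges w M" using f(2)[OF kE] k by simp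
    qed
  qed
  show ?thesis using sub[OF c c'] sub[OF c' c] by blast
qed

text \<open>
  The space of circulations has dimension at least \<open>2\<close>. So it contains a nonzero circulation
  that vanishes on a given edge of the first cycle, and its support contains a cycle that avoids
  this edge.
\<close>

lemma more_edges_imp_second_cycle:
  assumes m: "card V < card oarcs" and c: "closed_cycle E v L"
  shows "\<exists>v' L'. closed_cycle E v' L' \<and> cycle_edges v' L' \<noteq> cycle_edges v L"
proof -
  have v01: "(v 0, v 1) \<in> E" using c by (auto simp: closed_cycle_def)
  have mem: "{v 0, v 1} \<in> cycle_edges v L" using c by (force simp: cycle_edges_def closed_cycle_def)
  have V: "V \<noteq> {}" using v01 arc_tail by auto
  have "1 < kernel_dim (inc_mat 1)"
    using kernel_dim_inc_mat[of 1] kernel_dim_transpose_const[OF V] m by linarith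
  then obtain f e where f: "flow 1 f" "e \<in> E" "f e \<noteq> 0" "f (v 0, v 1) = 0"
    using flow_avoiding_arc[of 1 "(v 0, v 1)"] v01 by blast
  obtain v' L' where c': "closed_cycle E v' L'" and nz: "\<And>k. k < L' \<Longrightarrow> f (v' k, v' (Suc k)) \<noteq> 0"
    using flow_support_contains_cycle[of 1 f e] f by auto
  have f10: "f (v 1, v 0) = 0" using f(1,4) v01 by (auto simp: flow_def)
  have "{v 0, v 1} \<notin> cycle_edges v' L'"
  proof
    assume "{v 0, v 1} \<in> cycle_edges v' L'"
    then obtain k where "k < L'" "{v 0, v 1} = {v' k, v' (Suc k)}" unfolding cycle_edges_def by auto
    then show False using nz[of k] f(4) f10 by (auto simp: doubleton_eq_iff)
  qed
  then show ?thesis using c' mem by blast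
qed

text \<open>
  An even cycle carries an alternating symmetric flow; since \<open>m = n\<close>, the left kernel for
  \<open>\<epsilon> = -1\<close> is then nonzero too. Conversely a nonzero alternating function vanishes nowhere, by
  connectedness, and changes its sign \<open>L\<close> times on the way around the cycle.
\<close>

lemma even_cycle_iff_alternating:
  assumes m: "card oarcs = card V" and c: "closed_cycle E v L"
  shows "even L \<longleftrightarrow> (\<exists>x u. twisted_const (-1) x \<and> u \<in> V \<and> x u \<noteq> 0)"
proof
  assume "even L"
  have v01: "(v 0, v 1) \<in> E" using c by (auto simp: closed_cycle_def)
  have mem: "{v 0, v 1} \<in> cycle_edges v L" using c by (force simp: cycle_edges_def closed_cycle_def)
  obtain f where f: "flow (-1) f" "\<And>i j. (i, j) \<in> E \<Longrightarrow> f (i, j) \<noteq> 0 \<longleftrightarrow> {i, j} \<in> cycle_edges v L"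
    using cycle_flow[OF c, of "-1"] \<open>even L\<close> by auto
  have "0 < kernel_dim (inc_mat (-1))"
    using kernel_dim_flow_pos(1)[of "-1" f "(v 0, v 1)"] f v01 mem by simp
  then have "0 < kernel_dim (inc_mat (-1))\<^sup>T" using kernel_dim_inc_mat[of "-1"] m by simp
  then show "\<exists>x u. twisted_const (-1) x \<and> u \<in> V \<and> x u \<noteq> 0"
    by (subst (asm) kernel_dim_transpose_pos) simp_all
next
  assume "\<exists>x u. twisted_const (-1) x \<and> u \<in> V \<and> x u \<noteq> 0"
  then obtain x u where x: "twisted_const (-1) x" "u \<in> V" "x u \<noteq> 0" by blast
  obtain b where b: "\<And>w. w \<in> V \<Longrightarrow> x w * x w = b"
    using twisted_const_prod_const[OF conn _ x(1) x(1)] by auto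
  have "(v 0, v 1) \<in> E" using c by (auto simp: closed_cycle_def)
  then have v0: "v 0 \<in> V" by (rule arc_tail)
  then have nz: "x (v 0) \<noteq> 0" using b[OF x(2)] b[OF v0] x(3) by auto
  have "x (v k) = (-1) ^ k * x (v 0)" if "k \<le> L" for k
    using that
  proof (induction k)
    case (Suc k)
    then have "(v k, v (Suc k)) \<in> E" using c by (auto simp: closed_cycle_def)
    then have "x (v (Suc k)) = - x (v k)" using twisted_constD[OF x(1)] by fastforce
    then show ?case using Suc by simp
  qed simp
  from this[of L] have "x (v 0) = (-1) ^ L * x (v 0)" using c by (simp add: closed_cycle_def)
  then have "(-1 :: complex) ^ L = 1" using nz by simp
  then show "even L" by (cases "even L") simp_all
qed

end

section \<open>Cycles of the graph library\<close>

lemma cas_nth: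
  assumes "pre_digraph.cas (with_proj G) u p w" "k < length p"
  shows "p ! k = (pre_digraph.awalk_verts (with_proj G) u p ! k, pre_digraph.awalk_verts (with_proj G) u p ! Suc k)"
  using assms
proof (induction p arbitrary: u k)
  case (Cons e p)
  then show ?case
    by (cases k; cases p) (auto simp: pre_digraph.cas.simps pre_digraph.awalk_verts.simps prod_eq_iff)
qed simp

lemma cas_ends:
  "pre_digraph.cas (with_proj G) u p w \<Longrightarrow> pre_digraph.awalk_verts (with_proj G) u p ! 0 = u
    \<and> pre_digraph.awalk_verts (with_proj G) u p ! length p = w
    \<and> length (pre_digraph.awalk_verts (with_proj G) u p) = Suc (length p)"
  by (induction p arbitrary: u) (auto simp: pre_digraph.cas.simps pre_digraph.awalk_verts.simps)

lemma walk_along_vertices: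
  "a \<le> b \<Longrightarrow> pre_digraph.cas (with_proj G) (v a) (map (\<lambda>k. (v k, v (Suc k))) [a..<b]) (v b)
    \<and> pre_digraph.awalk_verts (with_proj G) (v a) (map (\<lambda>k. (v k, v (Suc k))) [a..<b]) = map v [a..<Suc b]"
proof (induction "b - a" arbitrary: a)
  case 0
  then show ?case by (simp add: pre_digraph.cas.simps pre_digraph.awalk_verts.simps)
next
  case (Suc n)
  then have ab: "a < b" by simp
  then have IH: "pre_digraph.cas (with_proj G) (v (Suc a)) (map (\<lambda>k. (v k, v (Suc k))) [Suc a..<b]) (v b)
    \<and> pre_digraph.awalk_verts (with_proj G) (v (Suc a)) (map (\<lambda>k. (v k, v (Suc k))) [Suc a..<b]) = map v [Suc a..<Suc b]"
    using Suc by (intro Suc.hyps(1)) auto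
  have u: "[a..<b] = a # [Suc a..<b]" "[a..<Suc b] = a # [Suc a..<Suc b]" using ab by (simp_all add: upt_conv_Cons)
  show ?case unfolding u list.map pre_digraph.cas.simps pre_digraph.awalk_verts.simps using IH by simp
qed

text \<open>
  A cycle of the library, a list of arcs, is read as the sequence of its vertices. There all
  vertices but the first are distinct; since the first one equals the last one, this is
  injectivity below \<open>L\<close>.
\<close>

lemma ucycles_eq:
  assumes tails: "\<And>i j. (i, j) \<in> parcs G \<Longrightarrow> i \<in> pverts G"
  shows "ucycles G = {cycle_edges v L | v L. closed_cycle (parcs G) v L}"
proof (intro Set.set_eqI iffI)
  fix C assume "C \<in> ucycles G"
  then obtain p where p: "C = (\<lambda>(u, v). {u, v}) ` set p" "3 \<le> length p" and "pre_digraph.cycle (with_proj G) p"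
    unfolding ucycles_def by blast
  then obtain u where aw: "pre_digraph.awalk (with_proj G) u p u"
    and dist: "distinct (tl (pre_digraph.awalk_verts (with_proj G) u p))"
    unfolding pre_digraph.cycle_def by blast
  define xs where "xs = pre_digraph.awalk_verts (with_proj G) u p"
  define L where "L = length p"
  have cas: "pre_digraph.cas (with_proj G) u p u" and sub: "set p \<subseteq> parcs G"
    using aw unfolding pre_digraph.awalk_def by auto
  have ends: "xs ! 0 = u" "xs ! L = u" "length xs = Suc L"
    using cas_ends[OF cas] unfolding xs_def L_def by auto
  have nth: "p ! k = (xs ! k, xs ! Suc k)" if "k < L" for k
    using cas_nth[OF cas] that unfolding xs_def L_def by blast
  have tl: "xs ! Suc i = xs ! Suc j \<Longrightarrow> i = j" if "i < L" "j < L" for i j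
    using dist that ends unfolding xs_def[symmetric] by (simp add: nth_tl[symmetric] nth_eq_iff_index_eq del: nth_tl)
  have "inj_on ((!) xs) {..<L}"
  proof (rule inj_onI)
    fix i j assume ij: "i \<in> {..<L}" "j \<in> {..<L}" "xs ! i = xs ! j"
    have "Suc (L - 1) = L" using p(2) by (simp add: L_def)
    then have L: "xs ! Suc (L - 1) = u" using ends by simp
    show "i = j"
    proof (cases i; cases j)
      fix i' j' assume "i = Suc i'" "j = Suc j'" then show ?thesis using tl[of i' j'] ij by auto
    next
      fix j' assume "i = 0" "j = Suc j'" then show ?thesis using tl[of "L - 1" j'] ij L ends by auto
    next
      fix i' assume "i = Suc i'" "j = 0" then show ?thesis using tl[of "L - 1" i'] ij L ends by auto
    qed simp
  qed
  moreover have "(xs ! k, xs ! Suc k) \<in> parcs G" if "k < L" for k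
    using nth[OF that] sub that unfolding L_def by (metis nth_mem subsetD)
  ultimately have "closed_cycle (parcs G) ((!) xs) L"
    using p(2) ends unfolding closed_cycle_def L_def by simp
  moreover have "C = cycle_edges ((!) xs) L"
  proof -
    have "set p = (!) p ` {..<L}" unfolding L_def by (auto simp: set_conv_nth)
    then show ?thesis unfolding p(1) cycle_edges_def image_image
      by (simp add: image_image nth cong: image_cong_simp)
  qed
  ultimately show "C \<in> {cycle_edges v L | v L. closed_cycle (parcs G) v L}" by blast
next
  fix C assume "C \<in> {cycle_edges v L | v L. closed_cycle (parcs G) v L}"
  then obtain v L where c: "closed_cycle (parcs G) v L" and C: "C = cycle_edges v L" by blast
  define p where "p = map (\<lambda>k. (v k, v (Suc k))) [0..<L]"
  have L: "3 \<le> L" and inj: "inj_on v {..<L}" and vL: "v L = v 0" and arc: "\<And>k. k < L \<Longrightarrow> (v k, v (Suc k)) \<in> parcs G"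
    using c by (auto simp: closed_cycle_def)
  note walk = walk_along_vertices[of 0 L G v, folded p_def]
  have v0: "v 0 \<in> pverts G" using tails[OF arc[of 0]] L by simp
  have "distinct (map v [1..<Suc L])"
  proof -
    have "inj_on v (set [1..<Suc L])"
    proof (rule inj_onI)
      fix i j assume ij: "i \<in> set [1..<Suc L]" "j \<in> set [1..<Suc L]" "v i = v j"
      define r where "r k = (if k = L then 0 else k)" for k
      have "v (r i) = v (r j)" "r i < L" "r j < L" using ij vL L by (auto simp: r_def)
      then have "r i = r j" using inj by (auto simp: inj_on_def)
      then show "i = j" using ij by (auto simp: r_def split: if_splits)
    qed
    then show ?thesis by (simp add: distinct_map del: upt_Suc)
  qed
  then have "distinct (tl (pre_digraph.awalk_verts (with_proj G) (v 0) p))"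
    using walk by (simp add: upt_conv_Cons del: upt_Suc)
  moreover have "pre_digraph.awalk (with_proj G) (v 0) p (v 0)"
    unfolding pre_digraph.awalk_def using walk v0 arc vL by (auto simp: p_def)
  ultimately have "pre_digraph.cycle (with_proj G) p"
    unfolding pre_digraph.cycle_def using L by (auto simp: p_def)
  moreover have "C = (\<lambda>(u, v). {u, v}) ` set p"
    unfolding C cycle_edges_def p_def by (auto simp: image_image)
  moreover have "3 \<le> length p" using L by (simp add: p_def)
  ultimately show "C \<in> ucycles G" unfolding ucycles_def by blast
qed

section \<open>The Jordan form of M\<close>

lemma jordan_nf_scalar:
  "jordan_nf (a \<cdot>\<^sub>m 1\<^sub>m d :: complex mat) (replicate d (1, a))"
proof -
  have "jordan_matrix (replicate d (1, a)) = a \<cdot>\<^sub>m 1\<^sub>m d"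
  proof (induction d)
    case 0
    then show ?case by (auto simp: jordan_matrix_def)
  next
    case (Suc d)
    show ?case unfolding replicate_Suc jordan_matrix_Cons Suc
      by (rule eq_matI) (auto simp: sum_list_replicate jordan_block_def)
  qed
  then show ?thesis
    unfolding jordan_nf_def using similar_mat_refl[of "a \<cdot>\<^sub>m 1\<^sub>m d" d] by auto
qed

lemma jordan_nf_M_mat:
  assumes JK: "jordan_nf (K_mat G) JK" and d: "d = card (uedges G) - card (pverts G)"
  shows "jordan_nf (M_mat G) (JK @ replicate d (1, 1) @ replicate d (1, -1))"
proof -
  have 1: "1 \<cdot>\<^sub>m 1\<^sub>m d = (1\<^sub>m d :: complex mat)" and 2: "(-1) \<cdot>\<^sub>m 1\<^sub>m d = (- 1\<^sub>m d :: complex mat)"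
    by (auto intro: eq_matI)
  have "jordan_nf (diag_block_mat (map fst [(K_mat G, JK), (1\<^sub>m d, replicate d (1, 1)), (- 1\<^sub>m d, replicate d (1, -1))]))
      (concat (map snd [(K_mat G, JK), (1\<^sub>m d, replicate d (1, 1)), (- 1\<^sub>m d, replicate d (1, -1))]))"
    by (rule jordan_nf_diag_block_mat)
      (use JK jordan_nf_scalar[of 1 d] jordan_nf_scalar[of "-1" d] 1 2 in auto)
  then show ?thesis by (simp add: M_mat_def d Let_def)
qed

lemma dim_gen_eigenspace_M_mat:
  assumes K: "K_mat G \<in> carrier_mat k k" and d: "d = card (uedges G) - card (pverts G)"
  shows "dim_gen_eigenspace (M_mat G) z 0 = 0"
    and "dim_gen_eigenspace (M_mat G) z (Suc j) = dim_gen_eigenspace (K_mat G) z (Suc j)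
      + (if z = 1 \<or> z = -1 then d else 0)"
proof -
  obtain as where "char_poly (K_mat G) = (\<Prod>a\<leftarrow>as. [:- a, 1:])"
    using char_poly_factorized[OF K] by auto
  then obtain JK where JK: "jordan_nf (K_mat G) JK" using jordan_nf_exists[OF K] by blast
  note dim = dim_gen_eigenspace[OF jordan_nf_M_mat[OF JK d]] dim_gen_eigenspace[OF JK]
  show "dim_gen_eigenspace (M_mat G) z 0 = 0" unfolding dim by simp
  show "dim_gen_eigenspace (M_mat G) z (Suc j) = dim_gen_eigenspace (K_mat G) z (Suc j)
      + (if z = 1 \<or> z = -1 then d else 0)"
    unfolding dim by (auto simp: sum_list_replicate filter_replicate)
qed

section \<open>The matrices of the statement\<close>

context arc_graph begin

lemma nb_mat_acts_as:
  assumes "distinct es" "set es = E"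
  shows "acts_as es es (nb_mat es) nb_op"
proof -
  define F :: "'v \<times> 'v \<Rightarrow> 'v \<times> 'v \<Rightarrow> complex"
    where "F a b = (if snd a = fst b \<and> fst a \<noteq> snd b then 1 else 0)" for a b
  have nb: "nb_mat es = mat (length es) (length es) (\<lambda>(p, q). F (es ! p) (es ! q))"
    by (rule eq_matI) (auto simp: nb_mat_def F_def split: prod.splits)
  show ?thesis unfolding nb
  proof (rule acts_as_mat[OF assms(1)])
    fix f e assume "e \<in> set es"
    then obtain i j where e: "e = (i, j)" and ij: "(i, j) \<in> E" using assms by (metis surj_pair)
    have "(\<Sum>b\<in>set es. F e b * f b) = (\<Sum>u\<in>V. \<Sum>w\<in>nbrs u. F e (u, w) * f (u, w))"
      unfolding assms(2) sum_arcs by (simp add: case_prod_unfold)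
    also have "\<dots> = (\<Sum>u\<in>V. if u = j then \<Sum>w\<in>nbrs j. if w = i then 0 else f (j, w) else 0)"
      by (intro sum.cong refl) (auto simp: F_def e intro!: sum.cong)
    also have "\<dots> = (\<Sum>w\<in>nbrs j. if w = i then 0 else f (j, w))"
      using arc_head[OF ij] finV by simp
    also have "\<dots> = (\<Sum>w\<in>nbrs j. f (j, w) - (if w = i then f (j, i) else 0))"
      by (intro sum.cong) auto
    also have "\<dots> = outsum f j - (\<Sum>w\<in>nbrs j. if w = i then f (j, i) else 0)"
      by (simp add: sum_subtractf outsum_def)
    also have "i \<in> nbrs j" using arc_sym[OF ij] by (simp add: nbrs_def)
    then have "(\<Sum>w\<in>nbrs j. if w = i then f (j, i) else 0) = f (j, i)" by simp
    finally show "nb_op f e = (\<Sum>b\<in>set es. F e b * f b)" by (simp add: nb_op_def e)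
  qed
qed

end

lemma K_mat_acts_as:
  assumes g: "arc_graph {1..n} (parcs G)" and V: "pverts G = {1..n}"
  shows "acts_as (map Inl [1..<Suc n] @ map Inr [1..<Suc n]) (map Inl [1..<Suc n] @ map Inr [1..<Suc n])
    (K_mat G) (arc_graph.K_op (parcs G))"
proof -
  interpret arc_graph "{1..n}" "parcs G" by (rule g)
  let ?vs = "[1..<Suc n]" let ?ks = "map Inl ?vs @ map Inr ?vs"
  define F :: "nat + nat \<Rightarrow> nat + nat \<Rightarrow> complex" where
    "F = case_sum
      (\<lambda>v. case_sum (\<lambda>w. if (v, w) \<in> parcs G then 1 else 0)
        (\<lambda>w. if v = w then of_nat (card (nbrs v)) - 1 else 0))
      (\<lambda>v. case_sum (\<lambda>w. if v = w then -1 else 0) (\<lambda>_. 0))"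
  have out: "out_degree (with_proj G) v = card (nbrs v)" for v
  proof -
    have "out_arcs (with_proj G) v = Pair v ` nbrs v" by (auto simp: out_arcs_def nbrs_def)
    then show ?thesis by (simp add: out_degree_def card_image inj_on_def)
  qed
  have dims: "adjacency_mat G \<in> carrier_mat n n" "deg_mat G \<in> carrier_mat n n"
    by (simp_all add: adjacency_mat_def deg_mat_def V)
  have nth: "?ks ! i = (if i < n then Inl (Suc i) else Inr (Suc (i - n)))" if "i < 2 * n" for i
    using that by (auto simp: nth_append simp del: upt_Suc)
  have K: "K_mat G = mat (length ?ks) (length ?ks) (\<lambda>(i, j). F (?ks ! i) (?ks ! j))"
  proof (rule eq_matI)
    fix i j assume "i < dim_row (mat (length ?ks) (length ?ks) (\<lambda>(i, j). F (?ks ! i) (?ks ! j)))"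
      "j < dim_col (mat (length ?ks) (length ?ks) (\<lambda>(i, j). F (?ks ! i) (?ks ! j)))"
    then have ij: "i < 2 * n" "j < 2 * n" by (simp_all del: upt_Suc)
    then have "mat (length ?ks) (length ?ks) (\<lambda>(i, j). F (?ks ! i) (?ks ! j)) $$ (i, j) = F (?ks ! i) (?ks ! j)"
      by (simp del: upt_Suc)
    moreover have "K_mat G $$ (i, j) = F (?ks ! i) (?ks ! j)"
      unfolding nth[OF ij(1)] nth[OF ij(2)] using ij dims
      by (auto simp: K_mat_def Let_def V F_def adjacency_mat_def deg_mat_def out)
    ultimately show "K_mat G $$ (i, j) = mat (length ?ks) (length ?ks) (\<lambda>(i, j). F (?ks ! i) (?ks ! j)) $$ (i, j)"
      by simp
  qed (use dims in \<open>auto simp: K_mat_def Let_def V\<close>)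
  have setvs: "set ?vs = {1..n}" by auto
  have ks: "set ?ks = Inl ` {1..n} \<union> Inr ` {1..n}" unfolding set_append set_map setvs ..
  have sum_ks: "(\<Sum>x\<in>set ?ks. c x) = (\<Sum>v\<in>{1..n}. c (Inl v)) + (\<Sum>v\<in>{1..n}. c (Inr v))" for c :: "_ \<Rightarrow> complex"
    unfolding ks by (subst sum.union_disjoint) (auto simp: sum.reindex)
  show ?thesis unfolding K
  proof (rule acts_as_mat)
    show "distinct ?ks" by (auto simp: distinct_map simp del: upt_Suc)
    fix f x assume "x \<in> set ?ks"
    then consider v where "x = Inl v" "v \<in> {1..n}" | v where "x = Inr v" "v \<in> {1..n}" unfolding ks by blast
    then show "K_op f x = (\<Sum>y\<in>set ?ks. F x y * f y)"
    proof cases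
      case 1
      have "(\<Sum>w\<in>{1..n}. (if (v, w) \<in> parcs G then 1 else 0) * f (Inl w)) = (\<Sum>w\<in>nbrs v. f (Inl w))"
        by (rule sum.mono_neutral_cong_right) (use arc_head in \<open>auto simp: nbrs_def\<close>)
      moreover have "(\<Sum>w\<in>{1..n}. (if v = w then of_nat (card (nbrs v)) - 1 else 0) * f (Inr w))
          = (of_nat (card (nbrs v)) - 1) * f (Inr v)"
        using 1(2) by (simp add: if_distrib[of "\<lambda>c. c * _"] cong: if_cong)
      ultimately show ?thesis unfolding sum_ks 1(1) by (simp add: F_def K_op_def)
    next
      case 2
      then show ?thesis unfolding sum_ks 2(1)
        by (simp add: F_def K_op_def if_distrib[of "\<lambda>c. c * _"] cong: if_cong)
    qed
  qed
qed

lemma adj_connected_connected: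
  assumes g: "arc_graph (pverts G) (parcs G)" and conn: "connected (with_proj G)"
  shows "arc_graph.adj_connected (pverts G) (parcs G)"
proof -
  interpret arc_graph "pverts G" "parcs G" by (rule g)
  show ?thesis unfolding adj_connected_def
  proof (intro allI impI ballI)
    fix c :: "_ \<Rightarrow> complex" and i j
    assume c: "\<forall>(i, j)\<in>parcs G. c i = c j" and "i \<in> pverts G" "j \<in> pverts G"
    then have "(i, j) \<in> rtrancl_on (pverts G) ((parcs G)\<^sup>s)"
      using conn by (simp add: connected_conv arcs_ends_def arc_to_ends_def)
    then show "c i = c j"
      by (induction rule: rtrancl_on.induct) (use c in \<open>auto simp: symcl_def\<close>)
  qed
qed

section \<open>Unicyclic graphs\<close>

theorem theorem2p7:
  fixes G :: "nat pair_pre_digraph" and n :: nat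
    and es :: "(nat \<times> nat) list"
    and JB JM :: "(nat \<times> complex) list"
  assumes "pair_graph G" and "pverts G = {1..n}"
    and "connected (with_proj G)" and "\<not> utree G"
    and "distinct es" and "set es = parcs G"
    and "jordan_nf (nb_mat es) JB" and "jordan_nf (M_mat G) JM"
  shows "(mset JB \<noteq> mset JM \<longleftrightarrow> unicyclic G) \<and>
    (unicyclic G \<longrightarrow> (\<forall>C \<in> ucycles G.
       (odd (card C) \<longrightarrow> {z. block_sizes JB z \<noteq> block_sizes JM z} = {1}) \<and>
       (even (card C) \<longrightarrow> {z. block_sizes JB z \<noteq> block_sizes JM z} = {1, -1})))"
proof -
  interpret G: pair_graph G by (rule assms(1))
  interpret arc_graph "{1..n}" "parcs G"
  proof
    fix i j assume "(i, j) \<in> parcs G"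
    then show "(j, i) \<in> parcs G" by (rule G.arcs_symmetric)
    show "i \<in> {1..n}" using G.in_arcsD1[OF \<open>(i, j) \<in> parcs G\<close>] assms(2) by simp
  next
    show "(i, i) \<notin> parcs G" for i using G.no_loops' by auto
  qed simp
  note axioms = arc_graph_axioms
  let ?vs = "[1..<Suc n]" and ?us = "filter (\<lambda>(i, j). i < j) es"
  interpret enumerated_arc_graph "{1..n}" "parcs G" ?vs ?us es "nb_mat es" "K_mat G"
  proof
    show "distinct ?vs" "set ?vs = {1..n}" by auto
    show "distinct ?us" using assms(5) by simp
    show "set ?us = oarcs" using assms(6) by (auto simp: oarcs_def)
    show "acts_as es es (nb_mat es) nb_op" by (rule nb_mat_acts_as[OF assms(5,6)])
    show "acts_as (map Inl ?vs @ map Inr ?vs) (map Inl ?vs @ map Inr ?vs) (K_mat G) K_op"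
      by (rule K_mat_acts_as[OF axioms assms(2)])
    show adj_connected
      using adj_connected_connected[of G] axioms assms(2,3) by simp
  qed (use assms in auto)
  have cycles: "ucycles G = {cycle_edges v L | v L. closed_cycle (parcs G) v L}"
    by (rule ucycles_eq) (use arc_tail assms(2) in auto)
  obtain v L where c: "closed_cycle (parcs G) v L"
    using assms(3,4) cycles unfolding utree_def by blast
  have edges: "card (uedges G) = card oarcs"
  proof -
    have "(\<lambda>(u, v). {u, v}) ` parcs G = (\<lambda>(u, v). {u, v}) ` oarcs"
      by (subst arcs_as_oarcs(1)) (auto simp: image_Un image_image case_prod_unfold insert_commute)
    moreover have "inj_on (\<lambda>(u, v). {u, v}) oarcs"
      by (auto simp: inj_on_def oarcs_def doubleton_eq_iff)
    ultimately show ?thesis unfolding uedges_def by (simp add: card_image)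
  qed
  have ge: "card {1..n} \<le> card oarcs" by (rule cycle_imp_edges_ge_vertices[OF c])
  have verts: "card (pverts G) = card {1..n}" using assms(2) by simp
  have "(v 0, v 1) \<in> parcs G" using c by (auto simp: closed_cycle_def)
  then have v0: "v 0 \<in> {1..n}" by (rule arc_tail)
  have unicyclic_iff: "unicyclic G \<longleftrightarrow> card oarcs = card {1..n}"
  proof
    assume u: "unicyclic G"
    show "card oarcs = card {1..n}"
    proof (rule ccontr)
      assume "card oarcs \<noteq> card {1..n}"
      then obtain v' L' where "closed_cycle (parcs G) v' L'" "cycle_edges v' L' \<noteq> cycle_edges v L"
        using more_edges_imp_second_cycle[OF _ c] ge by auto
      then show False using u c unfolding unicyclic_def cycles by blast
    qed
  next
    assume m: "card oarcs = card {1..n}"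
    show "unicyclic G"
      unfolding unicyclic_def cycles using assms(3) edges_eq_vertices_imp_unique_cycle[OF m _ c] c by blast
  qed
  define d where "d = card (uedges G) - card (pverts G)"
  have cK: "K_mat G \<in> carrier_mat (length ks) (length ks)" using acts_as_carrier[OF K] .
  note M = dim_gen_eigenspace_M_mat[OF cK d_def]
  have d: "d + card {1..n} = card oarcs" using ge verts edges by (simp add: d_def)
  have B0: "dim_gen_eigenspace (nb_mat es) z 0 = 0" for z
    unfolding dim_gen_eigenspace[OF assms(7)] by simp
  have differ: "block_sizes JB z \<noteq> block_sizes JM z \<longleftrightarrow> (z = 1 \<or> z = -1) \<and> \<not> no_defect z" for z
  proof (cases "z = 1 \<or> z = -1")
    case eps: True
    show ?thesis
    proof (cases "no_defect z")
      case True
      have "dim_gen_eigenspace (nb_mat es) z k = dim_gen_eigenspace (M_mat G) z k" for k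
      proof (cases k)
        case (Suc j)
        then show ?thesis using dim_gen_eigenspace_no_defect[OF eps True, of j] M(2)[of z j] d eps by auto
      qed (use B0 M(1) in simp)
      then show ?thesis using True block_sizes_eq_iff[OF assms(7,8)] by blast
    next
      case False
      then have "d = 0" using d unfolding no_defect_def by auto
      then have "dim_gen_eigenspace (M_mat G) z 1 \<noteq> dim_gen_eigenspace (nb_mat es) z 1"
        using dim_eigenspace_defect[OF eps False] M(2)[of z 0] by simp
      then show ?thesis using False eps block_sizes_eq_iff[OF assms(7,8)] by metis
    qed
  next
    case False
    then have z: "z * z \<noteq> 1" by (metis power2_eq_square power2_eq_1_iff)
    have "dim_gen_eigenspace (nb_mat es) z k = dim_gen_eigenspace (M_mat G) z k" for k
      using dim_gen_eigenspace_nb_K[OF z, of k] B0 M False by (cases k) auto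
    then show ?thesis using False block_sizes_eq_iff[OF assms(7,8)] by blast
  qed
  \<comment> \<open>For \<open>z = 1\<close> the constant function \<open>1\<close> is twisted constant, so only the edge count decides.\<close>
  have nd1: "no_defect 1 \<longleftrightarrow> card oarcs \<noteq> card {1..n}"
  proof -
    have "twisted_const 1 (\<lambda>_. 1)" by (auto simp: twisted_const_def)
    then have "\<not> (\<forall>x. twisted_const 1 x \<longrightarrow> (\<forall>v\<in>{1..n}. x v = 0))" 
      using v0 by (auto intro!: exI[of _ "\<lambda>_. 1"])
    then show ?thesis unfolding no_defect_def by blast
  qed
  have ndm: "no_defect (-1) \<longleftrightarrow> odd L'" if m: "card oarcs = card {1..n}" and "closed_cycle (parcs G) v' L'" for v' L'
    unfolding no_defect_def even_cycle_iff_alternating[OF that] using m by auto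
  have uniq: "mset JB \<noteq> mset JM \<longleftrightarrow> unicyclic G"
  proof
    assume "mset JB \<noteq> mset JM"
    then obtain z where "block_sizes JB z \<noteq> block_sizes JM z"
      unfolding mset_eq_iff_block_sizes_eq by blast
    then have "\<not> no_defect z" using differ by blast
    then show "unicyclic G" unfolding unicyclic_iff no_defect_def by blast
  next
    assume "unicyclic G"
    then show "mset JB \<noteq> mset JM"
      using differ[of 1] nd1 unfolding mset_eq_iff_block_sizes_eq unicyclic_iff by blast
  qed
  have "(odd (card C) \<longrightarrow> {z. block_sizes JB z \<noteq> block_sizes JM z} = {1}) \<and>
       (even (card C) \<longrightarrow> {z. block_sizes JB z \<noteq> block_sizes JM z} = {1, -1})"
    if u: "unicyclic G" and C_in: "C \<in> ucycles G" for C
  proof -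
    obtain v' L' where c': "closed_cycle (parcs G) v' L'" and C: "C = cycle_edges v' L'"
      using C_in unfolding cycles by blast
    have m: "card oarcs = card {1..n}" using u unicyclic_iff by simp
    have "\<not> no_defect 1" using nd1 m by simp
    moreover have "no_defect (-1) \<longleftrightarrow> odd (card C)"
      unfolding C card_cycle_edges[OF c'] by (rule ndm[OF m c'])
    ultimately show ?thesis unfolding differ by auto
  qed
  with uniq show ?thesis by blast
qed

end
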